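(* Let $X$ be a proper cocompact CAT(0) space with basepoint $x_0$, let $\omega$ be a non-principal ultrafilter on $\mathbb N$ and let $d$ be a scaling sequence. If the asymptotic cone $\mathrm{Con}^\omega(X,(x_0),d)$ has a cut-point, then all asymptotic cones of $X$ have cut-points and $X$ contains a periodic Morse geodesic.
   Context: A metric space is proper if closed balls are compact; it is cocompact if the translates of some compact set under its full isometry group cover it. For a non-principal ultrafilter $\omega$ on $\mathbb N$, a scaling sequence is a sequence $d=(d_n)$ of positive reals with $\lim^\omega d_n=\infty$. For a sequence $e=(e_n)$ in $X$, the asymptotic cone $\mathrm{Con}^\omega(X,e,d)$ is the set of sequences $(x_n)$ in $X$ with $\mathrm{dist}(x_n,e_n)/d_n$ bounded, modulo $(x_n)\sim(y_n)$ if $\lim^\omega \mathrm{dist}(x_n,y_n)/d_n=0$, with metric $\lim^\omega\mathrm{dist}(x_n,y_n)/d_n$. $(x_0)$ denotes the constant sequence. A cut-point of a connected space is a point whose complement is disconnected. A geodesic $\gamma$ is Morse if for every $L\ge1$ and $C\ge0$ there is $M=M(L,C)$ such that every $(L,C)$-quasi-geodesic with endpoints on $\gamma$ remains $M$-close to $\gamma$. A geodesic line is periodic if some isometry of $X$ acts on it as a nontrivial translation. *)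

theory Defs
  imports "HOL-Analysis.Analysis"
begin

section \<open>Isometries, proper and cocompact spaces\<close>

text \<open>A metric space is a type of class \<open>metric_space\<close>; properties of the whole space
  take the type as a \<open>itself\<close> argument.\<close>

definition isometries :: "('a::metric_space \<Rightarrow> 'a) set" where
  "isometries = {g. bij g \<and> (\<forall>x y. dist (g x) (g y) = dist x y)}"

definition proper_space :: "'a::metric_space itself \<Rightarrow> bool" where
  "proper_space _ \<longleftrightarrow> (\<forall>(x::'a) r. compact (cball x r))"

definition cocompact_space :: "'a::metric_space itself \<Rightarrow> bool" where
  "cocompact_space _ \<longleftrightarrow> (\<exists>K::'a set. compact K \<and> (\<Union>g\<in>isometries. g ` K) = UNIV)"

section \<open>Geodesics and CAT(0) spaces\<close>

definition geodesic_on :: "real set \<Rightarrow> (real \<Rightarrow> 'a::metric_space) \<Rightarrow> bool" where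
  "geodesic_on I \<gamma> \<longleftrightarrow> (\<forall>s\<in>I. \<forall>t\<in>I. dist (\<gamma> s) (\<gamma> t) = \<bar>s - t\<bar>)"

definition geodesic_segment :: "'a::metric_space set \<Rightarrow> 'a \<Rightarrow> 'a \<Rightarrow> bool" where
  "geodesic_segment S p q \<longleftrightarrow>
     (\<exists>\<gamma>. geodesic_on {0..dist p q} \<gamma> \<and> \<gamma> 0 = p \<and> \<gamma> (dist p q) = q \<and> S = \<gamma> ` {0..dist p q})"

definition geodesic_space :: "'a::metric_space itself \<Rightarrow> bool" where
  "geodesic_space _ \<longleftrightarrow> (\<forall>p q::'a. \<exists>S. geodesic_segment S p q)"

text \<open>\<open>x'\<close> is the point of the Euclidean side \<open>[p', q']\<close> corresponding to the point \<open>x\<close>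
  of the side \<open>S\<close> from \<open>p\<close> to \<open>q\<close>.\<close>

definition comparison_point ::
  "'a::metric_space set \<Rightarrow> 'a \<Rightarrow> real^2 \<Rightarrow> real^2 \<Rightarrow> 'a \<Rightarrow> real^2 \<Rightarrow> bool" where
  "comparison_point S p p' q' x x' \<longleftrightarrow>
     x \<in> S \<and> x' \<in> closed_segment p' q' \<and> dist p' x' = dist p x"

definition CAT0_space :: "'a::metric_space itself \<Rightarrow> bool" where
  "CAT0_space _ \<longleftrightarrow> geodesic_space TYPE('a) \<and>
     (\<forall>(p::'a) q r S\<^sub>1 S\<^sub>2 S\<^sub>3 p' q' r'.
        geodesic_segment S\<^sub>1 p q \<and> geodesic_segment S\<^sub>2 q r \<and> geodesic_segment S\<^sub>3 r p \<and>
        dist p' q' = dist p q \<and> dist q' r' = dist q r \<and> dist r' p' = dist r p \<longrightarrow>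
        (let cmp = (\<lambda>x x'. comparison_point S\<^sub>1 p p' q' x x' \<or>
                            comparison_point S\<^sub>2 q q' r' x x' \<or>
                            comparison_point S\<^sub>3 r r' p' x x')
         in \<forall>x y x' y'. cmp x x' \<and> cmp y y' \<longrightarrow> dist x y \<le> dist x' y'))"

section \<open>Periodic and Morse geodesics\<close>

definition quasi_geodesic ::
  "real \<Rightarrow> real \<Rightarrow> real \<Rightarrow> real \<Rightarrow> (real \<Rightarrow> 'a::metric_space) \<Rightarrow> bool" where
  "quasi_geodesic L C a b c \<longleftrightarrow> a \<le> b \<and>
     (\<forall>s\<in>{a..b}. \<forall>t\<in>{a..b}.
        \<bar>s - t\<bar> / L - C \<le> dist (c s) (c t) \<and> dist (c s) (c t) \<le> L * \<bar>s - t\<bar> + C)"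

definition morse_geodesic :: "real set \<Rightarrow> (real \<Rightarrow> 'a::metric_space) \<Rightarrow> bool" where
  "morse_geodesic I \<gamma> \<longleftrightarrow> geodesic_on I \<gamma> \<and>
     (\<forall>L C. L \<ge> 1 \<and> C \<ge> 0 \<longrightarrow>
        (\<exists>M. \<forall>a b c. quasi_geodesic L C a b c \<and> c a \<in> \<gamma> ` I \<and> c b \<in> \<gamma> ` I \<longrightarrow>
           (\<forall>t\<in>{a..b}. \<exists>s\<in>I. dist (c t) (\<gamma> s) \<le> M)))"

definition periodic_line :: "(real \<Rightarrow> 'a::metric_space) \<Rightarrow> bool" where
  "periodic_line \<gamma> \<longleftrightarrow> geodesic_on UNIV \<gamma> \<and>
     (\<exists>g\<in>isometries. \<exists>T. T \<noteq> 0 \<and> (\<forall>t. g (\<gamma> t) = \<gamma> (t + T)))"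

section \<open>Asymptotic cones\<close>

text \<open>Ultrafilters are represented as filters of type \<open>nat filter\<close>: a set belongs to the
  ultrafilter iff membership in it holds eventually. The limit along the ultrafilter is then
  the limit along the filter.\<close>

definition nonprincipal_ultrafilter :: "nat filter \<Rightarrow> bool" where
  "nonprincipal_ultrafilter \<omega> \<longleftrightarrow> \<omega> \<noteq> bot \<and>
     (\<forall>P. eventually P \<omega> \<or> eventually (\<lambda>n. \<not> P n) \<omega>) \<and>
     (\<forall>n. \<not> eventually (\<lambda>m. m = n) \<omega>)"

definition scaling_sequence :: "nat filter \<Rightarrow> (nat \<Rightarrow> real) \<Rightarrow> bool" where
  "scaling_sequence \<omega> d \<longleftrightarrow> (\<forall>n. d n > 0) \<and> filterlim d at_top \<omega>"

definition cone_seqs :: "(nat \<Rightarrow> 'a::metric_space) \<Rightarrow> (nat \<Rightarrow> real) \<Rightarrow> (nat \<Rightarrow> 'a) set" where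
  "cone_seqs e d = {x. bounded (range (\<lambda>n. dist (x n) (e n) / d n))}"

definition cone_rel ::
  "nat filter \<Rightarrow> (nat \<Rightarrow> 'a::metric_space) \<Rightarrow> (nat \<Rightarrow> real) \<Rightarrow> ((nat \<Rightarrow> 'a) \<times> (nat \<Rightarrow> 'a)) set" where
  "cone_rel \<omega> e d = {(x, y). x \<in> cone_seqs e d \<and> y \<in> cone_seqs e d \<and>
     ((\<lambda>n. dist (x n) (y n) / d n) \<longlongrightarrow> 0) \<omega>}"

definition cone_points ::
  "nat filter \<Rightarrow> (nat \<Rightarrow> 'a::metric_space) \<Rightarrow> (nat \<Rightarrow> real) \<Rightarrow> (nat \<Rightarrow> 'a) set set" where
  "cone_points \<omega> e d = cone_seqs e d // cone_rel \<omega> e d"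

text \<open>The value \<open>0\<close> outside the cone is only there because the locale \<open>Metric_space\<close> demands
  nonnegativity and symmetry of the distance also outside the carrier.\<close>

definition cone_dist ::
  "nat filter \<Rightarrow> (nat \<Rightarrow> 'a::metric_space) \<Rightarrow> (nat \<Rightarrow> real) \<Rightarrow> (nat \<Rightarrow> 'a) set \<Rightarrow> (nat \<Rightarrow> 'a) set \<Rightarrow> real"
  where
  "cone_dist \<omega> e d A B =
     (if A \<in> cone_points \<omega> e d \<and> B \<in> cone_points \<omega> e d
      then THE l. \<forall>x\<in>A. \<forall>y\<in>B. ((\<lambda>n. dist (x n) (y n) / d n) \<longlongrightarrow> l) \<omega>
      else 0)"

definition asymptotic_cone ::
  "nat filter \<Rightarrow> (nat \<Rightarrow> 'a::metric_space) \<Rightarrow> (nat \<Rightarrow> real) \<Rightarrow> (nat \<Rightarrow> 'a) set metric" where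
  "asymptotic_cone \<omega> e d = metric (cone_points \<omega> e d, cone_dist \<omega> e d)"

text \<open>The lemmas below show that the cone is well defined: along an ultrafilter the
  limits exist and do not depend on the representatives, and they give a metric.\<close>

lemma ultrafilter_bounded_tendsto:
  fixes f :: "nat \<Rightarrow> real"
  assumes u: "nonprincipal_ultrafilter \<omega>" and b: "bounded (range f)"
  obtains l where "(f \<longlongrightarrow> l) \<omega>"
proof -
  have nb: "\<omega> \<noteq> bot" and ult: "\<And>P. eventually P \<omega> \<or> eventually (\<lambda>n. \<not> P n) \<omega>"
    using u by (auto simp: nonprincipal_ultrafilter_def)
  have cpt: "compact (closure (range f))"
    using b by (simp add: compact_closure)
  have "filtermap f \<omega> \<noteq> bot"
    using nb by (simp add: filtermap_bot_iff)
  moreover have "eventually (\<lambda>x. x \<in> closure (range f)) (filtermap f \<omega>)"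
    using closure_subset[of "range f"] by (auto simp: eventually_filtermap intro!: always_eventually)
  ultimately obtain l where l: "inf (nhds l) (filtermap f \<omega>) \<noteq> bot"
    using cpt unfolding compact_filter by blast
  have "(f \<longlongrightarrow> l) \<omega>"
  proof (rule topological_tendstoI)
    fix S :: "real set" assume S: "open S" "l \<in> S"
    show "eventually (\<lambda>n. f n \<in> S) \<omega>"
    proof (rule ccontr)
      assume "\<not> eventually (\<lambda>n. f n \<in> S) \<omega>"
      with ult have "eventually (\<lambda>n. f n \<notin> S) \<omega>" by blast
      then have "eventually (\<lambda>x. x \<notin> S) (filtermap f \<omega>)"
        by (simp add: eventually_filtermap)
      moreover have "eventually (\<lambda>x. x \<in> S) (nhds l)"
        using S eventually_nhds by blast
      ultimately have "eventually (\<lambda>_. False) (inf (nhds l) (filtermap f \<omega>))"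
        unfolding eventually_inf by (intro exI conjI) (assumption | blast)+
      with l show False
        using trivial_limit_def by blast
    qed
  qed
  then show ?thesis using that by blast
qed

locale cone_data =
  fixes \<omega> :: "nat filter" and e :: "nat \<Rightarrow> 'a::metric_space" and d :: "nat \<Rightarrow> real"
  assumes ultra: "nonprincipal_ultrafilter \<omega>" and scaling: "scaling_sequence \<omega> d"
begin

lemma d_pos: "d n > 0" and nontriv: "\<omega> \<noteq> bot"
  using ultra scaling by (auto simp: nonprincipal_ultrafilter_def scaling_sequence_def)

lemma seq_dist_tendsto:
  assumes "x \<in> cone_seqs e d" "y \<in> cone_seqs e d"
  obtains l where "((\<lambda>n. dist (x n) (y n) / d n) \<longlongrightarrow> l) \<omega>"
proof -
  obtain B1 where B1: "\<And>n. \<bar>dist (x n) (e n) / d n\<bar> \<le> B1"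
    using assms(1) unfolding cone_seqs_def bounded_iff by auto
  obtain B2 where B2: "\<And>n. \<bar>dist (y n) (e n) / d n\<bar> \<le> B2"
    using assms(2) unfolding cone_seqs_def bounded_iff by auto
  have "\<bar>dist (x n) (y n) / d n\<bar> \<le> B1 + B2" for n
  proof -
    have "dist (x n) (y n) / d n \<le> (dist (x n) (e n) + dist (y n) (e n)) / d n"
      using d_pos[of n] by (intro divide_right_mono dist_triangle2) auto
    then show ?thesis
      using B1[of n] B2[of n] d_pos[of n] by (simp add: add_divide_distrib)
  qed
  then have "bounded (range (\<lambda>n. dist (x n) (y n) / d n))"
    unfolding bounded_iff by auto
  then show ?thesis
    using ultrafilter_bounded_tendsto[OF ultra] that by blast
qed

lemma dist_div_triangle: "dist (x n) (z n) / d n \<le> dist (x n) (y n) / d n + dist (y n) (z n) / d n"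
  using d_pos[of n] by (simp flip: add_divide_distrib add: divide_right_mono dist_triangle)

lemma equiv_cone_rel: "equiv (cone_seqs e d) (cone_rel \<omega> e d)"
proof (rule equivI)
  show "cone_rel \<omega> e d \<subseteq> cone_seqs e d \<times> cone_seqs e d"
    by (auto simp: cone_rel_def)
  show "refl_on (cone_seqs e d) (cone_rel \<omega> e d)"
    by (auto simp: refl_on_def cone_rel_def)
  show "sym (cone_rel \<omega> e d)"
    by (auto simp: sym_def cone_rel_def dist_commute)
  show "trans (cone_rel \<omega> e d)"
  proof (rule transI)
    fix x y z assume *: "(x, y) \<in> cone_rel \<omega> e d" "(y, z) \<in> cone_rel \<omega> e d"
    have s: "((\<lambda>n. dist (x n) (y n) / d n + dist (y n) (z n) / d n) \<longlongrightarrow> 0 + 0) \<omega>"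
      using * by (intro tendsto_add) (auto simp: cone_rel_def)
    have "((\<lambda>n. dist (x n) (z n) / d n) \<longlongrightarrow> 0) \<omega>"
      by (rule tendsto_sandwich[OF _ _ tendsto_const s[simplified]])
        (use d_pos dist_div_triangle in \<open>auto intro!: always_eventually simp: less_imp_le\<close>)
    with * show "(x, z) \<in> cone_rel \<omega> e d" by (auto simp: cone_rel_def)
  qed
qed

lemma cone_points_cases:
  assumes "A \<in> cone_points \<omega> e d"
  obtains x where "x \<in> A" "x \<in> cone_seqs e d" "A = cone_rel \<omega> e d `` {x}"
  using assms equiv_class_self[OF equiv_cone_rel] unfolding cone_points_def
  by (auto elim!: quotientE)

lemma tendsto_cone_dist:
  assumes A: "A \<in> cone_points \<omega> e d" and B: "B \<in> cone_points \<omega> e d"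
    and x: "x \<in> A" and y: "y \<in> B"
  shows "((\<lambda>n. dist (x n) (y n) / d n) \<longlongrightarrow> cone_dist \<omega> e d A B) \<omega>"
proof -
  have seqs: "u \<in> cone_seqs e d" if "u \<in> A \<or> u \<in> B" for u
    using that A B by (auto elim!: cone_points_cases simp: cone_rel_def)
  obtain l where l: "((\<lambda>n. dist (x n) (y n) / d n) \<longlongrightarrow> l) \<omega>"
    using seq_dist_tendsto x y seqs by blast
  have all: "\<forall>u\<in>A. \<forall>v\<in>B. ((\<lambda>n. dist (u n) (v n) / d n) \<longlongrightarrow> l) \<omega>"
  proof (intro ballI)
    fix u v assume u: "u \<in> A" and v: "v \<in> B"
    have "(x, u) \<in> cone_rel \<omega> e d" "(y, v) \<in> cone_rel \<omega> e d"
      using quotient_eq_iff[OF equiv_cone_rel, of A A x u] quotient_eq_iff[OF equiv_cone_rel, of B B y v]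
        A B x y u v by (auto simp: cone_points_def)
    then have s: "((\<lambda>n. dist (x n) (u n) / d n + dist (y n) (v n) / d n) \<longlongrightarrow> 0 + 0) \<omega>"
      by (intro tendsto_add) (auto simp: cone_rel_def)
    have bd: "\<bar>dist (u n) (v n) / d n - dist (x n) (y n) / d n\<bar>
        \<le> dist (x n) (u n) / d n + dist (y n) (v n) / d n" for n
      using dist_div_triangle[of u n v x] dist_div_triangle[of x n v y]
        dist_div_triangle[of x n y u] dist_div_triangle[of u n y v]
      by (simp add: dist_commute abs_le_iff)
    have "((\<lambda>n. dist (u n) (v n) / d n - dist (x n) (y n) / d n) \<longlongrightarrow> 0) \<omega>"
      by (rule Lim_null_comparison[OF _ s[simplified]])
         (intro always_eventually allI, simp only: real_norm_def bd)
    from tendsto_add[OF this l] show "((\<lambda>n. dist (u n) (v n) / d n) \<longlongrightarrow> l) \<omega>"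
      by simp
  qed
  have "(THE l. \<forall>u\<in>A. \<forall>v\<in>B. ((\<lambda>n. dist (u n) (v n) / d n) \<longlongrightarrow> l) \<omega>) = l"
  proof (rule the_equality, rule all)
    fix l' assume "\<forall>u\<in>A. \<forall>v\<in>B. ((\<lambda>n. dist (u n) (v n) / d n) \<longlongrightarrow> l') \<omega>"
    then show "l' = l" using x y l tendsto_unique[OF nontriv] by blast
  qed
  then have "cone_dist \<omega> e d A B = l"
    using A B by (simp add: cone_dist_def)
  with l show ?thesis by simp
qed

lemma Metric_space_cone: "Metric_space (cone_points \<omega> e d) (cone_dist \<omega> e d)"
proof
  fix A B C
  show nonneg: "0 \<le> cone_dist \<omega> e d A B"
  proof (cases "A \<in> cone_points \<omega> e d \<and> B \<in> cone_points \<omega> e d")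
    case True
    then obtain x y where "x \<in> A" "y \<in> B" by (meson cone_points_cases)
    with True show ?thesis
      using tendsto_lowerbound[OF tendsto_cone_dist _ nontriv] d_pos
      by (simp add: less_imp_le)
  qed (auto simp: cone_dist_def)
  show "cone_dist \<omega> e d A B = cone_dist \<omega> e d B A"
  proof (cases "A \<in> cone_points \<omega> e d \<and> B \<in> cone_points \<omega> e d")
    case True
    then obtain x y where "x \<in> A" "y \<in> B" by (meson cone_points_cases)
    with True show ?thesis
      using tendsto_unique[OF nontriv tendsto_cone_dist[of A B x y]] tendsto_cone_dist[of B A y x]
      by (simp add: dist_commute)
  qed (auto simp: cone_dist_def)
  assume A: "A \<in> cone_points \<omega> e d" and B: "B \<in> cone_points \<omega> e d"
  obtain x where x: "x \<in> A" "x \<in> cone_seqs e d" "A = cone_rel \<omega> e d `` {x}"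
    using A by (rule cone_points_cases)
  obtain y where y: "y \<in> B" "y \<in> cone_seqs e d" "B = cone_rel \<omega> e d `` {y}"
    using B by (rule cone_points_cases)
  have lim: "((\<lambda>n. dist (x n) (y n) / d n) \<longlongrightarrow> cone_dist \<omega> e d A B) \<omega>"
    using tendsto_cone_dist A B x y by blast
  have "A = B \<longleftrightarrow> (x, y) \<in> cone_rel \<omega> e d"
    using eq_equiv_class_iff[OF equiv_cone_rel] x y by simp
  also have "\<dots> \<longleftrightarrow> ((\<lambda>n. dist (x n) (y n) / d n) \<longlongrightarrow> 0) \<omega>"
    using x y by (auto simp: cone_rel_def)
  also have "\<dots> \<longleftrightarrow> cone_dist \<omega> e d A B = 0"
    using lim tendsto_unique[OF nontriv] by metis
  finally show "cone_dist \<omega> e d A B = 0 \<longleftrightarrow> A = B" by simp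
  assume C: "C \<in> cone_points \<omega> e d"
  obtain z where z: "z \<in> C" using C by (rule cone_points_cases)
  show "cone_dist \<omega> e d A C \<le> cone_dist \<omega> e d A B + cone_dist \<omega> e d B C"
    by (rule tendsto_le[OF nontriv tendsto_add[OF lim tendsto_cone_dist[OF B C y(1) z]]
          tendsto_cone_dist[OF A C x(1) z]])
       (intro always_eventually allI dist_div_triangle)
qed

lemma mspace_asymptotic_cone: "mspace (asymptotic_cone \<omega> e d) = cone_points \<omega> e d"
  and mdist_asymptotic_cone: "mdist (asymptotic_cone \<omega> e d) = cone_dist \<omega> e d"
  unfolding asymptotic_cone_def
  by (simp_all add: Metric_space.mspace_metric Metric_space.mdist_metric Metric_space_cone)

end

section \<open>Cut-points\<close>

definition cut_point :: "'a topology \<Rightarrow> 'a \<Rightarrow> bool" where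
  "cut_point X p \<longleftrightarrow> connected_space X \<and> p \<in> topspace X \<and>
     \<not> connected_space (subtopology X (topspace X - {p}))"

definition has_cut_point :: "'a metric \<Rightarrow> bool" where
  "has_cut_point m \<longleftrightarrow> (\<exists>p. cut_point (mtopology_of m) p)"

end

theory Submission
  imports Defs
begin

text \<open>Call two points of the cone related with respect to \<open>q\<close> if they are joined by a finite chain
  in which \<open>q\<close> is never metrically between consecutive points. At a cut-point some points are
  unrelated, and homogeneity then yields a sequence of isometries \<open>g\<^sub>n\<close> whose limit moves the base point
  \<open>u\<close> such that \<open>g u\<close> and \<open>g\<inverse> u\<close> are unrelated with respect to \<open>u\<close>. Consequently, for any \<open>x\<close> and \<open>y\<close>,
  either \<open>u\<close> lies between \<open>x\<close> and \<open>y\<close>, or it lies between both of them and \<open>g u\<close>, or between both of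
  them and \<open>g\<inverse> u\<close>. For a single large \<open>n\<close> this holds up to small error on a ball in \<open>X\<close>, and
  CAT(0) comparison extends it to all of \<open>X\<close>. Hence along the orbit \<open>p\<^sub>i = g\<^sub>n\<^sup>i x\<^sub>0\<close> every point \<open>x\<close> has a
  gate: moving along the orbit away from the gate increases the distance to \<open>x\<close> linearly, and points
  with different gates are far apart in comparison with their distance to the orbit. This contraction
  property gives an axis of \<open>g\<^sub>n\<close>, its Morse property, and a cut-point in every cone.\<close>

section \<open>The CAT(0) inequality\<close>

text \<open>The obstacle is scale: the cone sees only points within O(\<open>d n\<close>) of the
  base point, whereas gates need information about all of X. Unrelatedness is used instead of
  connected components because it gives an exact equality d(x, y) = d(x, u) + d(u, y), which
  survives in X up to a small multiple of D = d(b, g b) for almost all n; choosing a bad pair for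
  each n, if there is one, makes it uniform on the ball of radius D. The passage to all of X rests
  on comparison angles at the centre not decreasing when points move outwards along geodesics. The
  constants 3/4 and 1/4 serve this: for two points at distance D from the centre both give a
  distance of at least 7/4 D, and (7/4)^2 > 3 means a comparison angle above 120 degrees. Such an
  angle keeps an increase of D / 2 at any distance, while additivity weakens to a factor 1/2, still
  enough for contraction. Powers of g carry the separation at one point to the whole orbit, so one
  good n suffices. The axis then comes from a minimum of the displacement, which exists because of
  the gates.\<close>

lemma comparison_triangle_exists:
  fixes a b c :: real
  assumes "0 \<le> a" "0 \<le> b" "0 \<le> c" "a \<le> b + c" "b \<le> c + a" "c \<le> a + b"
  obtains q r :: "real^2" where "norm q = a" "norm r = b" "dist q r = c"
proof (cases "a = 0")
  case True
  then have "b = c" using assms by auto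
  moreover have "norm (vector [b, 0] :: real^2) = b"
    using \<open>0 \<le> b\<close> by (simp add: norm_vec_def L2_set_def UNIV_2)
  ultimately show ?thesis
    using that[of 0 "vector [b, 0]"] True by simp
next
  case False
  \<comment> \<open>The side of length a lies on the first axis, and u is the first coordinate of
    the third vertex by the law of cosines. The triangle inequalities amount to |u| <= b, so the
    second coordinate v is real.\<close>
  define u where "u = (a\<^sup>2 + b\<^sup>2 - c\<^sup>2) / (2 * a)"
  have au: "2 * a * u = a\<^sup>2 + b\<^sup>2 - c\<^sup>2" using False by (simp add: u_def)
  have "(a - b)\<^sup>2 \<le> c\<^sup>2" using assms by (intro power2_le_iff_abs_le[THEN iffD2]) auto
  then have "2 * a * u \<le> 2 * a * b" unfolding au by (simp add: power2_diff)
  then have ub: "u \<le> b" using False assms by simp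
  have "c\<^sup>2 \<le> (a + b)\<^sup>2" using assms by (intro power_mono) auto
  then have "2 * a * (- b) \<le> 2 * a * u" using au by (simp add: power2_sum)
  then have "- b \<le> u" using False assms by (subst (asm) mult_le_cancel_left_pos) auto
  with ub have "u\<^sup>2 \<le> b\<^sup>2" by (simp add: abs_le_iff power2_le_iff_abs_le \<open>0 \<le> b\<close>)
  then have v: "(sqrt (b\<^sup>2 - u\<^sup>2))\<^sup>2 = b\<^sup>2 - u\<^sup>2" by simp
  define v where "v = sqrt (b\<^sup>2 - u\<^sup>2)"
  have v2: "v\<^sup>2 = b\<^sup>2 - u\<^sup>2" using v by (simp add: v_def)
  show ?thesis
  proof (rule that[of "vector [a, 0]" "vector [u, v]"])
    show "norm (vector [a, 0] :: real^2) = a"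
      using assms by (simp add: norm_vec_def L2_set_def UNIV_2)
    show "norm (vector [u, v] :: real^2) = b"
      using assms v2 by (simp add: norm_vec_def L2_set_def UNIV_2)
    have "(a - u)\<^sup>2 + v\<^sup>2 = c\<^sup>2" using v2 au by (simp add: power2_diff)
    then show "dist (vector [a, 0] :: real^2) (vector [u, v]) = c"
      using assms by (simp add: dist_vec_def L2_set_def UNIV_2 dist_real_def)
  qed
qed

lemma geodesic_onD: "geodesic_on I \<gamma> \<Longrightarrow> s \<in> I \<Longrightarrow> t \<in> I \<Longrightarrow> dist (\<gamma> s) (\<gamma> t) = \<bar>s - t\<bar>"
  by (simp add: geodesic_on_def)

text \<open>\<open>CAT0_space\<close> compares points lying on given segments, while points are
  later known only by their distances to the endpoints. Equality in the triangle inequality makes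
  the concatenation of two geodesics at x a geodesic.\<close>

lemma geodesic_segment_through:
  fixes p q x :: "'a::metric_space"
  assumes geo: "geodesic_space TYPE('a)" and x: "dist p x + dist x q = dist p q"
  obtains S where "geodesic_segment S p q" "x \<in> S"
proof -
  define l where "l = dist p x"
  obtain \<gamma>1 where g1: "geodesic_on {0..l} \<gamma>1" "\<gamma>1 0 = p" "\<gamma>1 l = x"
    using geo unfolding geodesic_space_def geodesic_segment_def l_def by metis
  obtain \<gamma>2 where g2: "geodesic_on {0..dist x q} \<gamma>2" "\<gamma>2 0 = x" "\<gamma>2 (dist x q) = q"
    using geo unfolding geodesic_space_def geodesic_segment_def by metis
  define \<gamma> where "\<gamma> = (\<lambda>t. if t \<le> l then \<gamma>1 t else \<gamma>2 (t - l))"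
  have l0: "0 \<le> l" "l \<le> dist p q" using x by (auto simp: l_def) (metis le_add_same_cancel1 zero_le_dist)
  have le: "dist (\<gamma> s) (\<gamma> t) = t - s" if "0 \<le> s" "s \<le> t" "t \<le> dist p q" for s t
  proof -
    consider "t \<le> l" | "l < s" | "s \<le> l" "l < t" by linarith
    then show ?thesis
    proof cases
      case 1
      then show ?thesis using g1 that by (auto simp: \<gamma>_def geodesic_on_def)
    next
      case 2
      then show ?thesis using g2 that x by (auto simp: \<gamma>_def geodesic_on_def l_def)
    next
      case 3
      have 1: "dist (\<gamma>1 s) x = l - s" "dist p (\<gamma>1 s) = s"
        using g1 3 that l0 unfolding geodesic_on_def by (metis abs_of_nonpos atLeastAtMost_iff diff_le_0_iff_le minus_diff_eq order_refl, metis abs_of_nonneg abs_minus_commute atLeastAtMost_iff diff_zero order_refl)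
      have 2: "dist x (\<gamma>2 (t - l)) = t - l"
      proof -
        have "dist (\<gamma>2 0) (\<gamma>2 (t - l)) = \<bar>0 - (t - l)\<bar>"
          using geodesic_onD[OF g2(1)] 3 that x l0 by (auto simp: l_def)
        with g2 3 show ?thesis by simp
      qed
      have q3: "dist (\<gamma>2 (t - l)) q = dist x q - (t - l)"
      proof -
        have "dist (\<gamma>2 (t - l)) (\<gamma>2 (dist x q)) = \<bar>(t - l) - dist x q\<bar>"
          using geodesic_onD[OF g2(1)] 3 that x l0 by (auto simp: l_def)
        with g2 that x show ?thesis by (simp add: l_def)
      qed
      \<comment> \<open>The lower bound: a shortcut between the two halves would make the path from
        p to q shorter than d(p, q).\<close>
      have "dist p q \<le> dist p (\<gamma>1 s) + dist (\<gamma>1 s) (\<gamma>2 (t - l)) + dist (\<gamma>2 (t - l)) q"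
        using dist_triangle[of p q "\<gamma>1 s"] dist_triangle[of "\<gamma>1 s" q "\<gamma>2 (t - l)"] by linarith
      moreover have "dist (\<gamma>1 s) (\<gamma>2 (t - l)) \<le> dist (\<gamma>1 s) x + dist x (\<gamma>2 (t - l))"
        by (rule dist_triangle)
      ultimately show ?thesis using 1 2 q3 3 x by (auto simp: \<gamma>_def l_def)
    qed
  qed
  have gg: "geodesic_on {0..dist p q} \<gamma>"
    unfolding geodesic_on_def
  proof (intro ballI)
    fix s t assume "s \<in> {0..dist p q}" "t \<in> {0..dist p q}"
    then show "dist (\<gamma> s) (\<gamma> t) = \<bar>s - t\<bar>"
      using le[of s t] le[of t s] by (cases "s \<le> t") (auto simp: dist_commute)
  qed
  have ends: "\<gamma> 0 = p" "\<gamma> l = x" using g1 l0 by (auto simp: \<gamma>_def)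
  have "\<gamma> (dist p q) = q"
  proof (cases "x = q")
    case True
    then show ?thesis using x ends by (simp add: l_def)
  next
    case False
    then have "l < dist p q" "dist p q - l = dist x q" using x by (auto simp: l_def simp flip: x)
    then show ?thesis using g2 by (simp add: \<gamma>_def)
  qed
  then have "geodesic_segment (\<gamma> ` {0..dist p q}) p q"
    unfolding geodesic_segment_def using gg ends by blast
  moreover have "x \<in> \<gamma> ` {0..dist p q}" using ends l0 by (metis atLeastAtMost_iff image_eqI)
  ultimately show ?thesis using that by blast
qed

lemma geodesic_space_point:
  fixes p q :: "'a::metric_space"
  assumes geo: "geodesic_space TYPE('a)" and t: "0 \<le> t" "t \<le> 1"
  obtains x where "dist p x = t * dist p q" "dist x q = (1 - t) * dist p q"
proof -
  obtain \<gamma> where g: "geodesic_on {0..dist p q} \<gamma>" "\<gamma> 0 = p" "\<gamma> (dist p q) = q"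
    using geo unfolding geodesic_space_def geodesic_segment_def by metis
  have m: "t * dist p q \<in> {0..dist p q}" using t by (auto simp: mult_left_le_one_le)
  have "dist (\<gamma> 0) (\<gamma> (t * dist p q)) = \<bar>0 - t * dist p q\<bar>"
    using geodesic_onD[OF g(1)] m by auto
  moreover have "dist (\<gamma> (t * dist p q)) (\<gamma> (dist p q)) = \<bar>t * dist p q - dist p q\<bar>"
    using geodesic_onD[OF g(1)] m by auto
  ultimately show ?thesis
    using that[of "\<gamma> (t * dist p q)"] g t m by (auto simp: algebra_simps)
qed

text \<open>Comparison for points on the two sides issuing from p: the right-hand side is |t q' - s
  r'|^2 in the plane, with the inner product expressed by the law of cosines. All later uses of
  curvature go through this inequality.\<close>

lemma CAT0_inequality:
  fixes p q r x y :: "'a::metric_space"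
  assumes cat: "CAT0_space TYPE('a)"
    and t: "0 \<le> t" "t \<le> 1" "dist p x = t * dist p q" "dist x q = (1 - t) * dist p q"
    and s: "0 \<le> s" "s \<le> 1" "dist p y = s * dist p r" "dist y r = (1 - s) * dist p r"
  shows "(dist x y)\<^sup>2 \<le> t\<^sup>2 * (dist p q)\<^sup>2 + s\<^sup>2 * (dist p r)\<^sup>2
           - t * s * ((dist p q)\<^sup>2 + (dist p r)\<^sup>2 - (dist q r)\<^sup>2)"
proof -
  have geo: "geodesic_space TYPE('a)" using cat by (simp add: CAT0_space_def)
  have through: "dist p x + dist x q = dist p q" "dist r y + dist y p = dist r p"
    using t s by (simp_all add: algebra_simps dist_commute)
  obtain S1 where S1: "geodesic_segment S1 p q" "x \<in> S1"
    using geodesic_segment_through[OF geo, of p x q] through(1) by blast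
  obtain S2 where S2: "geodesic_segment S2 q r"
    using geo unfolding geodesic_space_def by blast
  obtain S3 where S3: "geodesic_segment S3 r p" "y \<in> S3"
    using geodesic_segment_through[OF geo, of r y p] through(2) by blast
  obtain q' r' :: "real^2" where qr: "norm q' = dist p q" "norm r' = dist p r" "dist q' r' = dist q r"
    using comparison_triangle_exists[of "dist p q" "dist p r" "dist q r"]
    by (smt (verit) dist_commute dist_triangle zero_le_dist)
  have cx: "comparison_point S1 p 0 q' x (t *\<^sub>R q')"
    using S1 t qr by (auto simp: comparison_point_def closed_segment_def intro!: exI[of _ t])
  have "r' - s *\<^sub>R r' = (1 - s) *\<^sub>R r'" by (simp add: algebra_simps)
  then have "dist r' (s *\<^sub>R r') = (1 - s) * dist p r"
    using s qr by (simp add: dist_norm)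
  \<comment> \<open>The third side runs from r to p, hence the parameter 1 - s.\<close>
  then have cy: "comparison_point S3 r r' 0 y (s *\<^sub>R r')"
    using S3 s qr
    by (auto simp: comparison_point_def closed_segment_def dist_commute intro!: exI[of _ "1 - s"])
  have "dist 0 q' = dist p q" "dist r' 0 = dist r p" using qr by (auto simp: dist_commute)
  then have "dist x y \<le> dist (t *\<^sub>R q') (s *\<^sub>R r')"
    using cat S1(1) S2 S3(1) qr(3) cx cy unfolding CAT0_space_def Let_def by blast
  then have "(dist x y)\<^sup>2 \<le> (dist (t *\<^sub>R q') (s *\<^sub>R r'))\<^sup>2"
    by (intro power_mono) auto
  also have "\<dots> = t\<^sup>2 * (norm q')\<^sup>2 + s\<^sup>2 * (norm r')\<^sup>2 - t * s * (2 * (q' \<bullet> r'))"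
    unfolding dist_norm power2_norm_eq_inner
    by (simp add: inner_diff_left inner_diff_right inner_commute power2_eq_square algebra_simps)
  also have "2 * (q' \<bullet> r') = (norm q')\<^sup>2 + (norm r')\<^sup>2 - (dist q' r')\<^sup>2"
    unfolding dist_norm power2_norm_eq_inner
    by (simp add: inner_diff_left inner_diff_right inner_commute)
  finally show ?thesis using qr by simp
qed

lemma ratio_cancel:
  fixes a D :: real
  assumes "0 < a"
  shows "D / a * a = D" "(1 - D / a) * a = a - D"
  using assms by (simp_all add: left_diff_distrib)

text \<open>At p the comparison angle of \<open>x1\<close> and w has cosine at most -17/32 < -1/2,
  and that of x and w is at least as large. With a = d(p, x) the law of cosines then gives d(x, w)^2
  >= a^2 + a D + D^2 / 4 = (a + D / 2)^2.\<close>

lemma forward_extension: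
  fixes p w x x1 :: "'a::metric_space"
  assumes cat: "CAT0_space TYPE('a)" and D: "0 < D" "dist p w = D" "D < dist p x"
    and x1: "dist p x1 = D" "dist x1 x = dist p x - D"
    and far: "D + 3 / 4 * D \<le> dist x1 w"
  shows "dist p x + D / 2 \<le> dist x w"
proof -
  define a where "a = dist p x"
  define X where "X = dist x w"
  have a: "0 < a" "D < a" using D by (auto simp: a_def)
  have "(dist x1 w)\<^sup>2 \<le> (D / a)\<^sup>2 * (dist p x)\<^sup>2 + 1\<^sup>2 * (dist p w)\<^sup>2
           - (D / a) * 1 * ((dist p x)\<^sup>2 + (dist p w)\<^sup>2 - (dist x w)\<^sup>2)"
    using a D x1 ratio_cancel[OF a(1), of D]
    by (intro CAT0_inequality[OF cat]) (simp_all flip: a_def)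
  then have "(dist x1 w)\<^sup>2 \<le> 2 * D\<^sup>2 - (D / a) * (a\<^sup>2 + D\<^sup>2 - X\<^sup>2)"
    using a D by (simp add: power_divide X_def flip: a_def)
  moreover have "(7 / 4 * D)\<^sup>2 \<le> (dist x1 w)\<^sup>2" using far D by (intro power_mono) auto
  ultimately have "(D / a) * (a\<^sup>2 + D\<^sup>2 - X\<^sup>2) \<le> - (17 / 16) * D\<^sup>2"
    by (simp add: power2_eq_square)
  then have "D * (a\<^sup>2 + D\<^sup>2 - X\<^sup>2) \<le> D * (- (17 / 16) * D * a)"
    using a by (simp add: field_simps power2_eq_square)
  then have "a\<^sup>2 + D\<^sup>2 - X\<^sup>2 \<le> - (17 / 16) * D * a"
    using D by (simp only: mult_le_cancel_left_pos)
  moreover have "0 \<le> D * a" using a D by simp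
  ultimately have "a\<^sup>2 + D\<^sup>2 / 4 + D * a \<le> X\<^sup>2" using zero_le_power2[of D] by linarith
  then have "(a + D / 2)\<^sup>2 \<le> X\<^sup>2" by (simp add: power2_sum power_divide algebra_simps)
  then show ?thesis unfolding a_def X_def by (rule power2_le_imp_le) simp
qed

text \<open>The points \<open>x1\<close> and \<open>y1\<close> are x and y pulled back radially into
  the ball. If x and y both lie outside, their comparison angle at p exceeds 120 degrees and the law
  of cosines gives more than (a + b)^2 / 4.\<close>

lemma separation_extension:
  fixes p x y x1 y1 :: "'a::metric_space"
  assumes cat: "CAT0_space TYPE('a)" and D: "0 < D"
    and x1: "dist p x1 = min D (dist p x)" "dist x1 x = dist p x - dist p x1"
    and y1: "dist p y1 = min D (dist p y)" "dist y1 y = dist p y - dist p y1"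
    and far: "dist p x1 + dist p y1 - D / 4 \<le> dist x1 y1"
  shows "1 / 2 * (dist p x + dist p y) - D \<le> dist x y"
proof -
  \<comment> \<open>The mixed case, x inside the ball and y outside. The angle at p need not be
    obtuse when x is close to p, but \<open>D < b\<close> absorbs the positive term 7/16 D
    b.\<close>
  have one: "1 / 2 * (dist p x + dist p y) \<le> dist x y"
    if x1: "dist p x1 = dist p x" and y1: "dist p y1 = D" "dist y1 y = dist p y - D"
      and gt: "D < dist p y" and far: "dist p x + D - D / 4 \<le> dist x y1" for x y x1 y1
  proof -
    define a where "a = dist p x"
    define b where "b = dist p y"
    define X where "X = dist x y"
    have ab: "0 \<le> a" "D < b" "0 < b" using gt D by (auto simp: a_def b_def)
    have s: "0 \<le> D / b" "D / b \<le> 1" "dist p y1 = D / b * dist p y" "dist y1 y = (1 - D / b) * dist p y"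
      using ab D(1) y1 ratio_cancel[OF ab(3), of D] unfolding b_def by simp_all
    have t: "0 \<le> (1::real)" "(1::real) \<le> 1" "dist p x = 1 * dist p x" "dist x x = (1 - 1) * dist p x"
      by simp_all
    have "(dist x y1)\<^sup>2 \<le> 1\<^sup>2 * (dist p x)\<^sup>2 + (D / b)\<^sup>2 * (dist p y)\<^sup>2
           - 1 * (D / b) * ((dist p x)\<^sup>2 + (dist p y)\<^sup>2 - (dist x y)\<^sup>2)"
      by (rule CAT0_inequality[OF cat t s])
    then have "(dist x y1)\<^sup>2 \<le> a\<^sup>2 + D\<^sup>2 - (D / b) * (a\<^sup>2 + b\<^sup>2 - X\<^sup>2)"
      using ab by (simp add: power_divide X_def flip: a_def b_def)
    moreover have "(a + 3 / 4 * D)\<^sup>2 \<le> (dist x y1)\<^sup>2"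
      using far D ab by (intro power_mono) (auto simp: a_def)
    moreover have "(a + 3 / 4 * D)\<^sup>2 = a\<^sup>2 + 3 / 2 * a * D + 9 / 16 * D\<^sup>2"
      by (simp add: power2_eq_square algebra_simps)
    ultimately have "(D / b) * (a\<^sup>2 + b\<^sup>2 - X\<^sup>2) \<le> 7 / 16 * D\<^sup>2 - 3 / 2 * a * D"
      by linarith
    then have "D * (a\<^sup>2 + b\<^sup>2 - X\<^sup>2) \<le> D * (b * (7 / 16 * D - 3 / 2 * a))"
      using ab by (simp add: field_simps power2_eq_square)
    then have "a\<^sup>2 + b\<^sup>2 - X\<^sup>2 \<le> b * (7 / 16 * D - 3 / 2 * a)"
      using D by (simp only: mult_le_cancel_left_pos)
    also have "\<dots> \<le> b * (7 / 16 * b - 3 / 2 * a)" using ab by (intro mult_left_mono) auto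
    finally have "a\<^sup>2 + 9 / 16 * b\<^sup>2 + 3 / 2 * (a * b) \<le> X\<^sup>2"
      by (simp add: power2_eq_square algebra_simps)
    moreover have "0 \<le> a * b" using ab by simp
    ultimately have "1 / 4 * a\<^sup>2 + 1 / 4 * b\<^sup>2 + 1 / 2 * (a * b) \<le> X\<^sup>2"
      using zero_le_power2[of a] zero_le_power2[of b] by linarith
    then have "(1 / 2 * (a + b))\<^sup>2 \<le> X\<^sup>2" by (simp add: power2_eq_square algebra_simps)
    then show ?thesis unfolding a_def b_def X_def by (rule power2_le_imp_le) simp
  qed
  consider "dist p x \<le> D" "dist p y \<le> D" | "dist p x \<le> D" "D < dist p y"
    | "D < dist p x" "dist p y \<le> D" | "D < dist p x" "D < dist p y" by linarith
  then show ?thesis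
  proof cases
    case 1
    then have "x1 = x" "y1 = y" using x1 y1 by auto
    then show ?thesis using far D by (simp add: field_simps) (smt (verit) zero_le_dist)
  next
    case 2
    then have "x1 = x" using x1 by auto
    then have "1 / 2 * (dist p x + dist p y) \<le> dist x y" using one[of x x1 y1 y] 2 x1 y1 far by auto
    then show ?thesis using D by linarith
  next
    case 3
    then have "y1 = y" using y1 by auto
    then have "1 / 2 * (dist p y + dist p x) \<le> dist y x"
      using one[of y y1 x1 x] 3 x1 y1 far by (auto simp: dist_commute)
    then have "1 / 2 * (dist p x + dist p y) \<le> dist x y"
      unfolding add.commute[of "dist p y"] dist_commute[of y x] .
    then show ?thesis using D by linarith
  next
    case 4
    define a where "a = dist p x"
    define b where "b = dist p y"
    define X where "X = dist x y"
    have ab: "0 < a" "D < a" "D < b" "0 < b" using 4 D by (auto simp: a_def b_def)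
    have x1': "dist p x1 = D" "dist x1 x = a - D" and y1': "dist p y1 = D" "dist y1 y = b - D"
      using 4 x1 y1 by (auto simp: a_def b_def)
    have "(dist x1 y1)\<^sup>2 \<le> (D / a)\<^sup>2 * (dist p x)\<^sup>2 + (D / b)\<^sup>2 * (dist p y)\<^sup>2
           - (D / a) * (D / b) * ((dist p x)\<^sup>2 + (dist p y)\<^sup>2 - (dist x y)\<^sup>2)"
      using ab D x1' y1' ratio_cancel[OF ab(1), of D] ratio_cancel[OF ab(4), of D]
      by (intro CAT0_inequality[OF cat]) (simp_all flip: a_def b_def)
    then have "(dist x1 y1)\<^sup>2 \<le> 2 * D\<^sup>2 - (D / a) * (D / b) * (a\<^sup>2 + b\<^sup>2 - X\<^sup>2)"
      using ab by (simp add: power_divide X_def flip: a_def b_def)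
    moreover have "(7 / 4 * D)\<^sup>2 \<le> (dist x1 y1)\<^sup>2"
      using far D x1' y1' by (intro power_mono) auto
    ultimately have "(D / a) * (D / b) * (a\<^sup>2 + b\<^sup>2 - X\<^sup>2) \<le> - (17 / 16) * D\<^sup>2"
      by (simp add: power2_eq_square algebra_simps)
    then have "D\<^sup>2 * (a\<^sup>2 + b\<^sup>2 - X\<^sup>2) \<le> D\<^sup>2 * (- (17 / 16) * (a * b))"
      using ab by (simp add: field_simps power2_eq_square)
    then have "a\<^sup>2 + b\<^sup>2 - X\<^sup>2 \<le> - (17 / 16) * (a * b)"
      using D by (simp only: mult_le_cancel_left_pos zero_less_power)
    moreover have "0 \<le> a * b" using ab by simp
    ultimately have "1 / 4 * a\<^sup>2 + 1 / 4 * b\<^sup>2 + 1 / 2 * (a * b) \<le> X\<^sup>2"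
      using zero_le_power2[of a] zero_le_power2[of b] by linarith
    then have "(1 / 2 * (a + b))\<^sup>2 \<le> X\<^sup>2" by (simp add: power2_eq_square algebra_simps)
    then have "1 / 2 * (a + b) \<le> X" unfolding X_def by (rule power2_le_imp_le) simp
    then show ?thesis unfolding a_def b_def X_def using D by linarith
  qed
qed

lemma separation_local_to_global:
  fixes p w w' :: "'a::metric_space"
  assumes cat: "CAT0_space TYPE('a)" and D: "0 < D" "dist p w = D" "dist p w' = D"
    and loc: "\<And>x y. \<lbrakk>dist p x \<le> D; dist p y \<le> D\<rbrakk> \<Longrightarrow>
      dist p x + 3 / 4 * D \<le> dist x w \<and> dist p y + 3 / 4 * D \<le> dist y w \<or>
      dist p x + 3 / 4 * D \<le> dist x w' \<and> dist p y + 3 / 4 * D \<le> dist y w' \<or>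
      dist p x + dist p y - D / 4 \<le> dist x y"
  shows "dist p x + D / 2 \<le> dist x w \<and> dist p y + D / 2 \<le> dist y w \<or>
      dist p x + D / 2 \<le> dist x w' \<and> dist p y + D / 2 \<le> dist y w' \<or>
      1 / 2 * (dist p x + dist p y) - D \<le> dist x y"
    and "dist p x + D / 2 \<le> dist x w \<or> dist p x + D / 2 \<le> dist x w'"
proof -
  have geo: "geodesic_space TYPE('a)" using cat by (simp add: CAT0_space_def)
  have "\<exists>x1. dist p x1 = min D (dist p x) \<and> dist x1 x = dist p x - dist p x1" for x
  proof (cases "D < dist p x")
    case True
    then have pos: "0 < dist p x" using D by linarith
    have "0 \<le> D / dist p x" "D / dist p x \<le> 1" using True D(1) pos by simp_all
    then obtain x1 where "dist p x1 = D / dist p x * dist p x" "dist x1 x = (1 - D / dist p x) * dist p x"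
      using geodesic_space_point[OF geo, of "D / dist p x" p x] by blast
    then have "dist p x1 = D" "dist x1 x = dist p x - D" by (simp_all only: ratio_cancel[OF pos])
    then show ?thesis using True by auto
  qed (auto intro!: exI[of _ x])
  then obtain \<pi> where \<pi>: "\<And>x. dist p (\<pi> x) = min D (dist p x)" "\<And>x. dist (\<pi> x) x = dist p x - dist p (\<pi> x)"
    by metis
  have ext: "dist p x + D / 2 \<le> dist x v"
    if "dist p (\<pi> x) + 3 / 4 * D \<le> dist (\<pi> x) v" "dist p v = D" for x v
  proof (cases "D < dist p x")
    case True
    then show ?thesis using forward_extension[OF cat D(1) that(2) True, of "\<pi> x"] \<pi>[of x] that by simp
  next
    case False
    then have "\<pi> x = x" using \<pi>[of x] by simp
    then show ?thesis using that D by simp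
  qed
  have loc': "dist p (\<pi> x) + 3 / 4 * D \<le> dist (\<pi> x) w \<and> dist p (\<pi> y) + 3 / 4 * D \<le> dist (\<pi> y) w \<or>
      dist p (\<pi> x) + 3 / 4 * D \<le> dist (\<pi> x) w' \<and> dist p (\<pi> y) + 3 / 4 * D \<le> dist (\<pi> y) w' \<or>
      dist p (\<pi> x) + dist p (\<pi> y) - D / 4 \<le> dist (\<pi> x) (\<pi> y)" for x y
    by (rule loc) (simp_all add: \<pi>(1))
  show "dist p x + D / 2 \<le> dist x w \<and> dist p y + D / 2 \<le> dist y w \<or>
      dist p x + D / 2 \<le> dist x w' \<and> dist p y + D / 2 \<le> dist y w' \<or>
      1 / 2 * (dist p x + dist p y) - D \<le> dist x y"
    using loc'[of x y] ext D separation_extension[OF cat D(1) \<pi> \<pi>, of x y] by blast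
  show "dist p x + D / 2 \<le> dist x w \<or> dist p x + D / 2 \<le> dist x w'"
  \<comment> \<open>With y = x the third local alternative says that \<open>\<pi> x\<close> is
    within D / 8 of p, and then the triangle inequality alone suffices: D - D / 8 = D / 8 + 3 / 4
    D.\<close>
  proof (cases "dist p (\<pi> x) \<le> D / 8")
    case True
    have "D \<le> dist p (\<pi> x) + dist (\<pi> x) w" using dist_triangle[of p w "\<pi> x"] D by simp
    then show ?thesis using ext[of x w] True D by simp
  next
    case False
    then show ?thesis using loc'[of x x] ext D by auto
  qed
qed

section \<open>Isometries of minimal displacement\<close>

definition zpow :: "('a \<Rightarrow> 'a) \<Rightarrow> int \<Rightarrow> 'a \<Rightarrow> 'a" where
  "zpow g i = (if 0 \<le> i then g ^^ nat i else (inv g) ^^ nat (- i))"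

lemma zpow_0: "zpow g 0 x = x"
  by (simp add: zpow_def)

lemma zpow_Suc: "zpow g (i + 1) x = g (zpow g i x)" if "bij g"
proof (cases "0 \<le> i")
  case True
  then show ?thesis by (simp add: zpow_def nat_add_distrib)
next
  case False
  then have "nat (- i) = Suc (nat (- (i + 1)))" by simp
  then show ?thesis using that False by (cases "i = -1") (auto simp: zpow_def bij_is_surj surj_f_inv_f)
qed

lemma zpow_Suc2: "zpow g (i + 1) x = zpow g i (g x)" if "bij g"
proof (induction i rule: int_induct[where k = 0])
  case base
  then show ?case using zpow_Suc[OF that, of 0] by (simp add: zpow_0)
next
  case (step1 i)
  have "zpow g (i + 1 + 1) x = g (zpow g (i + 1) x)" by (rule zpow_Suc[OF that])
  also have "\<dots> = zpow g (i + 1) (g x)" using step1 zpow_Suc[OF that, of i "g x"] by simp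
  finally show ?case .
next
  case (step2 i)
  have "g (zpow g i x) = g (zpow g (i - 1) (g x))"
    using step2 zpow_Suc[OF that, of i x] zpow_Suc[OF that, of "i - 1" "g x"] by simp
  then show ?case using that by (simp add: bij_is_inj inj_eq)
qed

lemma zpow_add: "zpow g (i + j) x = zpow g i (zpow g j x)" if "bij g"
proof (induction i rule: int_induct[where k = 0])
  case base
  then show ?case by (simp add: zpow_0)
next
  case (step1 i)
  then show ?case using zpow_Suc[OF that, of "i + j" x] zpow_Suc[OF that, of i] by (simp add: algebra_simps)
next
  case (step2 i)
  have "g (zpow g (i - 1 + j) x) = g (zpow g (i - 1) (zpow g j x))"
    using step2 zpow_Suc[OF that, of "i - 1 + j" x] zpow_Suc[OF that, of "i - 1" "zpow g j x"]
    by (simp add: algebra_simps)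
  then show ?case using that by (simp add: bij_is_inj inj_eq)
qed

lemma isometriesD:
  assumes "g \<in> isometries"
  shows "bij g" "dist (g x) (g y) = dist x y"
  using assms by (auto simp: isometries_def)

lemma isometries_inv: "inv g \<in> isometries" if "g \<in> isometries"
  using that unfolding isometries_def
  by (auto simp: bij_imp_bij_inv) (metis bij_inv_eq_iff)

lemma isometries_comp: "g \<in> isometries \<Longrightarrow> h \<in> isometries \<Longrightarrow> g \<circ> h \<in> isometries"
  by (auto simp: isometries_def bij_comp)

lemma isometries_funpow:
  assumes "g \<in> isometries"
  shows "g ^^ n \<in> isometries"
proof (induction n)
  case 0
  show ?case by (simp add: isometries_def flip: id_def)
next
  case (Suc n)
  then show ?case using assms isometries_comp by (simp only: funpow.simps)
qed

lemma dist_zpow: "dist (zpow g i x) (zpow g i y) = dist x y" if "g \<in> isometries"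
  using isometries_funpow[OF that] isometries_funpow[OF isometries_inv[OF that]]
  by (auto simp: zpow_def isometriesD)

lemma inv_zpow: "zpow g (- i) (zpow g i x) = x" "zpow g i (zpow g (- i) x) = x" if "bij g"
  using zpow_add[OF that, of "- i" i x] zpow_add[OF that, of i "- i" x] by (simp_all add: zpow_0)

text \<open>g maps the midpoint m of y and g y to the midpoint of g y and g (g y). Comparison at the
  apex g y gives d(m, g m) <= d(y, g (g y)) / 2, and T bounds the left side from below.\<close>

lemma displacement_double:
  assumes cat: "CAT0_space TYPE('a::metric_space)" and g: "g \<in> isometries"
    and T: "\<And>y::'a. T \<le> dist y (g y)"
  shows "2 * T \<le> dist y (g (g y))"
proof -
  have geo: "geodesic_space TYPE('a)" using cat by (simp add: CAT0_space_def)
  obtain m where m: "dist y m = 1 / 2 * dist y (g y)" "dist m (g y) = (1 - 1 / 2) * dist y (g y)"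
    using geodesic_space_point[OF geo, of "1 / 2" y "g y"] by auto
  have gd: "dist (g u) (g v) = dist u v" for u v using g by (rule isometriesD)
  have "(dist m (g m))\<^sup>2 \<le> (1 / 2)\<^sup>2 * (dist (g y) y)\<^sup>2 + (1 / 2)\<^sup>2 * (dist (g y) (g (g y)))\<^sup>2
      - 1 / 2 * (1 / 2) * ((dist (g y) y)\<^sup>2 + (dist (g y) (g (g y)))\<^sup>2 - (dist y (g (g y)))\<^sup>2)"
    by (rule CAT0_inequality[OF cat]) (use m gd in \<open>simp_all add: dist_commute\<close>)
  then have "(dist m (g m))\<^sup>2 \<le> (dist y (g (g y)) / 2)\<^sup>2"
    by (simp add: power2_eq_square algebra_simps)
  then have "dist m (g m) \<le> dist y (g (g y)) / 2" by (rule power2_le_imp_le) simp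
  then show ?thesis using T[of m] by simp
qed

text \<open>The bound is uniform in y, so doubling can be repeated with \<open>g ^^ 2 ^ k\<close> in
  place of g.\<close>

lemma displacement_power:
  assumes cat: "CAT0_space TYPE('a::metric_space)" and g: "g \<in> isometries"
    and T: "\<And>y::'a. T \<le> dist y (g y)"
  shows "2 ^ k * T \<le> dist y ((g ^^ 2 ^ k) y)"
proof (induction k arbitrary: y)
  case (Suc k)
  have "2 * (2 ^ k * T) \<le> dist y ((g ^^ 2 ^ k) ((g ^^ 2 ^ k) y))"
    by (rule displacement_double[OF cat isometries_funpow[OF g] Suc])
  also have "(g ^^ 2 ^ k) ((g ^^ 2 ^ k) y) = (g ^^ 2 ^ Suc k) y"
    by (simp only: power_Suc mult_2 funpow_add o_apply)
  finally show ?case by (simp only: power_Suc mult.assoc)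
qed (use T in simp)

text \<open>The upper bound n T is the triangle inequality. It is sharp at powers of two, and a
  strict loss at n would persist at 2^n, which is reached from n by 2^n - n further steps of length
  T.\<close>

lemma minimal_displacement_orbit:
  assumes cat: "CAT0_space TYPE('a::metric_space)" and g: "g \<in> isometries"
    and T: "\<And>y::'a. dist x (g x) \<le> dist y (g y)"
  shows "dist (zpow g i x) (zpow g j x) = \<bar>i - j\<bar> * dist x (g x)"
proof -
  define T where "T = dist x (g x)"
  have b: "bij g" using g isometriesD by blast
  have step: "dist (zpow g l x) (zpow g (l + 1) x) = T" for l
    using zpow_Suc2[OF b, of l x] dist_zpow[OF g, of l x "g x"] by (simp add: T_def)
  have upper: "dist (zpow g l x) (zpow g (l + int n) x) \<le> n * T" for l n
  proof (induction n)
    case (Suc n)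
    then show ?case
      using step[of "l + int n"] dist_triangle[of "zpow g l x" "zpow g (l + int (Suc n)) x" "zpow g (l + int n) x"]
      by (simp add: algebra_simps)
  qed simp
  have eq: "dist (zpow g l x) (zpow g (l + int n) x) = n * T" for l n
  proof (rule antisym[OF upper])
    define m where "m = 2 ^ n - n"
    have m: "real m = 2 ^ n - real n" "n + m = 2 ^ n"
      using less_exp[of n] by (auto simp: m_def of_nat_diff less_imp_le)
    have "2 ^ n * T \<le> dist (zpow g l x) ((g ^^ 2 ^ n) (zpow g l x))"
      by (rule displacement_power[OF cat g]) (use assms in \<open>auto simp: T_def\<close>)
    also have "(g ^^ 2 ^ n) (zpow g l x) = zpow g (l + int (2 ^ n)) x"
      using zpow_add[OF b, of "int (2 ^ n)" l x] by (simp add: zpow_def[of g "2 ^ n"] nat_power_eq add.commute)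
    also have "\<dots> = zpow g (l + int n + int m) x" by (simp add: m(2)[symmetric] algebra_simps)
    also have "dist (zpow g l x) \<dots> \<le> dist (zpow g l x) (zpow g (l + int n) x) + m * T"
      using upper[of "l + int n" m] dist_triangle[of "zpow g l x" "zpow g (l + int n + int m) x" "zpow g (l + int n) x"]
      by linarith
    finally show "n * T \<le> dist (zpow g l x) (zpow g (l + int n) x)" using m by (simp add: algebra_simps)
  qed
  show ?thesis
    using eq[of i "nat (j - i)"] eq[of j "nat (i - j)"]
    by (cases "i \<le> j") (auto simp: T_def dist_commute)
qed

text \<open>The axis is made of the translates of one geodesic from x to g x. It is geodesic across
  the joints because a shortcut would also shorten the distance of two orbit points, which is
  exact.\<close>

lemma axis_exists:
  assumes geo: "geodesic_space TYPE('a::metric_space)" and g: "g \<in> isometries"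
    and T: "0 < (T::real)" and orbit: "\<And>i j. dist (zpow g i x) (zpow g j (x::'a)) = \<bar>i - j\<bar> * T"
  obtains \<gamma> where "geodesic_on UNIV \<gamma>" "\<And>t. g (\<gamma> t) = \<gamma> (t + T)" "\<And>i. \<gamma> (of_int i * T) = zpow g i x"
proof -
  have b: "bij g" using g isometriesD by blast
  define a where "a = (\<lambda>i. zpow g i x)"
  have xg: "dist x (g x) = T" using orbit[of 0 1] zpow_Suc[OF b, of 0 x] by (simp add: zpow_0)
  obtain \<gamma>0 where \<gamma>0: "geodesic_on {0..T} \<gamma>0" "\<gamma>0 0 = x" "\<gamma>0 T = g x"
    using geo xg unfolding geodesic_space_def geodesic_segment_def by metis
  define \<gamma> where "\<gamma> = (\<lambda>t. zpow g \<lfloor>t / T\<rfloor> (\<gamma>0 (t - T * \<lfloor>t / T\<rfloor>)))"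
  have fl: "T * \<lfloor>t / T\<rfloor> \<le> t" "t \<le> T * (\<lfloor>t / T\<rfloor> + 1)" for t :: real
    using floor_divide_lower[OF T, of t] floor_divide_upper[OF T, of t] by (simp_all add: mult.commute)
  have left: "dist (a \<lfloor>t / T\<rfloor>) (\<gamma> t) = t - T * \<lfloor>t / T\<rfloor>"
    and right: "dist (\<gamma> t) (a (\<lfloor>t / T\<rfloor> + 1)) = T * (\<lfloor>t / T\<rfloor> + 1) - t" for t :: real
  proof -
    have m: "t - T * \<lfloor>t / T\<rfloor> \<in> {0..T}" using fl[of t] by (auto simp: algebra_simps)
    show "dist (a \<lfloor>t / T\<rfloor>) (\<gamma> t) = t - T * \<lfloor>t / T\<rfloor>"
      using geodesic_onD[OF \<gamma>0(1), of 0 "t - T * \<lfloor>t / T\<rfloor>"] m \<gamma>0 dist_zpow[OF g]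
      by (simp add: a_def \<gamma>_def)
    have "a (\<lfloor>t / T\<rfloor> + 1) = zpow g \<lfloor>t / T\<rfloor> (g x)" by (simp only: a_def zpow_Suc2[OF b])
    then show "dist (\<gamma> t) (a (\<lfloor>t / T\<rfloor> + 1)) = T * (\<lfloor>t / T\<rfloor> + 1) - t"
      using geodesic_onD[OF \<gamma>0(1), of "t - T * \<lfloor>t / T\<rfloor>" T] m \<gamma>0 dist_zpow[OF g] T
      by (simp add: \<gamma>_def algebra_simps)
  qed
  have ord: "dist (\<gamma> s) (\<gamma> t) = t - s" if "s \<le> t" for s t
  proof -
    define i where "i = \<lfloor>s / T\<rfloor>"
    define j where "j = \<lfloor>t / T\<rfloor>"
    have ij: "i \<le> j" using that T by (simp add: i_def j_def floor_mono divide_right_mono)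
    have "(j + 1 - i) * T \<le> dist (a i) (\<gamma> s) + dist (\<gamma> s) (\<gamma> t) + dist (\<gamma> t) (a (j + 1))"
      using orbit[of i "j + 1"] ij dist_triangle[of "a i" "a (j + 1)" "\<gamma> s"] dist_triangle[of "\<gamma> s" "a (j + 1)" "\<gamma> t"]
      by (simp add: a_def)
    then have ge: "t - s \<le> dist (\<gamma> s) (\<gamma> t)"
      using left[of s] right[of t] by (simp add: i_def[symmetric] j_def[symmetric] algebra_simps)
    have le: "dist (\<gamma> s) (\<gamma> t) \<le> t - s"
    proof (cases "i = j")
      case True
      have "dist (\<gamma> s) (\<gamma> t) = dist (\<gamma>0 (s - T * i)) (\<gamma>0 (t - T * i))"
        using True dist_zpow[OF g] by (simp add: \<gamma>_def i_def j_def)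
      also have "\<dots> = \<bar>(s - T * i) - (t - T * i)\<bar>"
        using fl[of s] fl[of t] True unfolding i_def[symmetric] j_def[symmetric]
        by (intro geodesic_onD[OF \<gamma>0(1)]) (auto simp: algebra_simps)
      finally show ?thesis using that by simp
    next
      case False
      have "dist (\<gamma> s) (\<gamma> t) \<le> dist (\<gamma> s) (a (i + 1)) + dist (a (i + 1)) (a j) + dist (a j) (\<gamma> t)"
        using dist_triangle[of "\<gamma> s" "\<gamma> t" "a (i + 1)"] dist_triangle[of "a (i + 1)" "\<gamma> t" "a j"] by linarith
      also have "dist (a (i + 1)) (a j) = (j - i - 1) * T"
        using orbit[of "i + 1" j] ij False by (simp add: a_def)
      finally show ?thesis using left[of t] right[of s]
        by (simp add: i_def[symmetric] j_def[symmetric] algebra_simps)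
    qed
    show ?thesis using ge le by simp
  qed
  have "geodesic_on UNIV \<gamma>"
    unfolding geodesic_on_def
  proof (intro ballI)
    fix s t :: real
    show "dist (\<gamma> s) (\<gamma> t) = \<bar>s - t\<bar>"
      using ord[of s t] ord[of t s] by (cases "s \<le> t") (auto simp: dist_commute)
  qed
  moreover have "g (\<gamma> t) = \<gamma> (t + T)" for t
  proof -
    have "\<lfloor>(t + T) / T\<rfloor> = \<lfloor>t / T\<rfloor> + 1" using T by (simp add: add_divide_distrib)
    then show ?thesis unfolding \<gamma>_def by (simp only: zpow_Suc[OF b]) (simp add: algebra_simps)
  qed
  moreover have "\<gamma> (of_int i * T) = zpow g i x" for i
    using T \<gamma>0 by (simp add: \<gamma>_def)
  ultimately show ?thesis using that by blast
qed

section \<open>Separation in homogeneous pseudometric spaces\<close>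

text \<open>A linked pair is one whose geodesics all avoid q. As q itself is linked to nothing, it
  is trivially unrelated to all other points; hence the positive distances to q required
  below.\<close>

definition links :: "('s \<Rightarrow> 's \<Rightarrow> real) \<Rightarrow> 's set \<Rightarrow> 's \<Rightarrow> ('s \<times> 's) set" where
  "links \<delta> S q = {(x, y). x \<in> S \<and> y \<in> S \<and> \<delta> x y < \<delta> x q + \<delta> q y}"

text \<open>The carrier will consist of sequences in X rather than classes, so that sequences of
  isometries act without a choice of representatives. The price is that transitivity holds only up
  to distance 0.\<close>

locale homogeneous_pseudometric =
  fixes S :: "'s set" and \<delta> :: "'s \<Rightarrow> 's \<Rightarrow> real" and G :: "('s \<Rightarrow> 's) set" and u :: 's
  assumes refl: "x \<in> S \<Longrightarrow> \<delta> x x = 0"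
    and commute: "\<lbrakk>x \<in> S; y \<in> S\<rbrakk> \<Longrightarrow> \<delta> x y = \<delta> y x"
    and triangle: "\<lbrakk>x \<in> S; y \<in> S; z \<in> S\<rbrakk> \<Longrightarrow> \<delta> x z \<le> \<delta> x y + \<delta> y z"
    and base: "u \<in> S"
    and maps: "\<lbrakk>g \<in> G; x \<in> S\<rbrakk> \<Longrightarrow> g x \<in> S"
    and preserves: "\<lbrakk>g \<in> G; x \<in> S; y \<in> S\<rbrakk> \<Longrightarrow> \<delta> (g x) (g y) = \<delta> x y"
    and comp: "\<lbrakk>g \<in> G; h \<in> G\<rbrakk> \<Longrightarrow> g \<circ> h \<in> G"
    and inverse: "g \<in> G \<Longrightarrow> \<exists>h\<in>G. \<forall>x\<in>S. h (g x) = x \<and> g (h x) = x"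
    and transitive: "x \<in> S \<Longrightarrow> \<exists>g\<in>G. \<delta> x (g u) = 0"
begin

lemma nonneg: "0 \<le> \<delta> x y" if "x \<in> S" "y \<in> S"
  using triangle[of x y x] commute[of x y] refl[of x] that by simp

abbreviation related :: "'s \<Rightarrow> ('s \<times> 's) set" where
  "related q \<equiv> (links \<delta> S q)\<^sup>*"

lemma related_sym: "(y, x) \<in> related q" if "(x, y) \<in> related q" "q \<in> S"
proof -
  have "sym (links \<delta> S q)" using that commute by (auto simp: links_def sym_def)
  then show ?thesis using that sym_rtrancl by (metis symD)
qed

lemma related_image: "(g x, g y) \<in> related (g q)" if "(x, y) \<in> related q" "g \<in> G" "q \<in> S"
  using that(1)
proof induction
  case (step y z)
  then have "(g y, g z) \<in> links \<delta> S (g q)" using that maps preserves by (auto simp: links_def)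
  with step show ?case by auto
qed simp

lemma links_cong: "links \<delta> S q = links \<delta> S q'" if "q \<in> S" "q' \<in> S" "\<delta> q q' = 0"
proof -
  have "\<delta> x q = \<delta> x q'" if "x \<in> S" for x
    using triangle[of x q q'] triangle[of x q' q] commute[of q q'] \<open>\<delta> q q' = 0\<close> \<open>q \<in> S\<close> \<open>q' \<in> S\<close> that
    by simp
  then have "\<delta> x q = \<delta> x q'" "\<delta> q x = \<delta> q' x" if "x \<in> S" for x
    using commute[of x q] commute[of x q'] that \<open>q \<in> S\<close> \<open>q' \<in> S\<close> by auto
  then show ?thesis by (auto simp: links_def)
qed

lemma unrelated_dist: "\<delta> x y = \<delta> x q + \<delta> q y"
  if "(x, y) \<notin> related q" "x \<in> S" "y \<in> S" "q \<in> S"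
  using that triangle[of x q y] by (force simp: links_def)

text \<open>The inverse of f moves q to u, up to distance 0; then the images of a and b are replaced
  by orbit points at distance 0, to which they are linked because they are off u.\<close>

lemma unrelated_orbit_exists:
  assumes q: "q \<in> S" "a \<in> S" "b \<in> S" "0 < \<delta> a q" "0 < \<delta> b q" and ab: "(a, b) \<notin> related q"
  obtains g h where "g \<in> G" "h \<in> G" "0 < \<delta> (g u) u" "0 < \<delta> (h u) u" "(g u, h u) \<notin> related u"
proof -
  obtain f where f: "f \<in> G" "\<delta> q (f u) = 0" using transitive q by blast
  obtain f' where f': "f' \<in> G" "\<forall>x\<in>S. f' (f x) = x \<and> f (f' x) = x" using inverse f by blast
  have ab': "(a, b) \<notin> related (f u)"
    using ab links_cong[of q "f u"] f q maps base by auto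
  have qf: "\<delta> x q = \<delta> x (f u)" if "x \<in> S" for x
    using triangle[of x q "f u"] triangle[of x "f u" q] f q that maps[OF f(1) base] commute[of q "f u"] by simp
  obtain g where g: "g \<in> G" "\<delta> (f' a) (g u) = 0" using transitive maps f' q by blast
  obtain h where h: "h \<in> G" "\<delta> (f' b) (h u) = 0" using transitive maps f' q by blast
  have pos: "0 < \<delta> (f' a) u" "0 < \<delta> (f' b) u"
    using preserves[of f "f' a" u] preserves[of f "f' b" u] f f' q base maps qf by auto
  have near: "(x, y) \<in> links \<delta> S u \<and> 0 < \<delta> y u" if "\<delta> x y = 0" "0 < \<delta> x u" "x \<in> S" "y \<in> S" for x y
    using that nonneg[of u y] triangle[of x y u] base commute[of u y] by (auto simp: links_def)
  have S: "f' a \<in> S" "f' b \<in> S" "g u \<in> S" "h u \<in> S" using f' g h maps q base by auto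
  have "(g u, h u) \<notin> related u"
  proof
    assume "(g u, h u) \<in> related u"
    moreover have "(f' a, g u) \<in> related u" "(f' b, h u) \<in> related u"
      using near g h pos S by blast+
    ultimately have "(f' a, f' b) \<in> related u" using related_sym base by (meson rtrancl_trans)
    then have "(f (f' a), f (f' b)) \<in> related (f u)" using related_image f base by blast
    then show False using ab' f' q by simp
  qed
  then show ?thesis using that g h near pos S by blast
qed

text \<open>If every \<open>g u \<noteq> u\<close> were related to \<open>g\<inverse> u\<close>, then for \<open>g u\<close> and \<open>h u\<close> on different sides of
  \<open>u\<close> one would get \<open>g u \<sim> g\<inverse> u \<sim> g\<inverse> h u \<sim> h\<inverse> g u \<sim> h\<inverse> u \<sim> h u\<close>.\<close>

lemma axial_element_exists:
  assumes "q \<in> S" "a \<in> S" "b \<in> S" "0 < \<delta> a q" "0 < \<delta> b q" "(a, b) \<notin> related q"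
  obtains g g' where "g \<in> G" "g' \<in> G" "\<And>x. x \<in> S \<Longrightarrow> g' (g x) = x \<and> g (g' x) = x"
    "0 < \<delta> (g u) u" "(g u, g' u) \<notin> related u"
proof (rule ccontr)
  note goal = that
  assume no: "\<not> thesis"
  have all: "(g u, g' u) \<in> related u"
    if "g \<in> G" "g' \<in> G" "\<And>x. x \<in> S \<Longrightarrow> g' (g x) = x \<and> g (g' x) = x" "0 < \<delta> (g u) u" for g g'
    using no that goal by blast
  obtain g h where gh: "g \<in> G" "h \<in> G" "0 < \<delta> (g u) u" "0 < \<delta> (h u) u" "(g u, h u) \<notin> related u"
    using unrelated_orbit_exists[OF assms] by blast
  obtain g' where g': "g' \<in> G" "\<And>x. x \<in> S \<Longrightarrow> g' (g x) = x \<and> g (g' x) = x" using inverse gh by blast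
  obtain h' where h': "h' \<in> G" "\<And>x. x \<in> S \<Longrightarrow> h' (h x) = x \<and> h (h' x) = x" using inverse gh by blast
  have S: "g u \<in> S" "h u \<in> S" "g' u \<in> S" "h' u \<in> S" "g' (h u) \<in> S" "h' (g u) \<in> S"
    using gh g' h' base maps by auto
  have dgh: "\<delta> (g u) (h u) = \<delta> (g u) u + \<delta> u (h u)"
    using unrelated_dist[OF gh(5)] S base by simp
  have 1: "(g u, g' u) \<in> related u" "(h u, h' u) \<in> related u"
    using all gh g' h' by blast+
  \<comment> \<open>Applying g turns this into d(u, h u) < d(u, g u) + d(g u, h u), which follows
    from \<open>dgh\<close>. The next step is the same with g and h exchanged.\<close>
  have 2: "(g' u, g' (h u)) \<in> links \<delta> S u"
    using S base gh preserves[OF g'(1), of u "h u"] preserves[OF gh(1), of "g' u" u]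
      preserves[OF gh(1), of u "g' (h u)"] dgh g' commute[of u "g u"]
    by (auto simp: links_def)
  have 3: "(h' u, h' (g u)) \<in> links \<delta> S u"
    using S base gh preserves[OF h'(1), of u "g u"] preserves[OF gh(2), of "h' u" u]
      preserves[OF gh(2), of u "h' (g u)"] dgh h' commute[of u "h u"] commute[of u "g u"] commute[of "g u" "h u"]
    by (auto simp: links_def)
  \<comment> \<open>The two maps are inverse to each other, and the first moves u by d(h u, g u) >
    0, so \<open>all\<close> applies to them.\<close>
  have 4: "((g' \<circ> h) u, (h' \<circ> g) u) \<in> related u"
  proof (rule all)
    have "\<delta> ((g' \<circ> h) u) u = \<delta> (h u) (g u)"
      using preserves[OF gh(1), of "g' (h u)" u] S base g' by simp
    then show "0 < \<delta> ((g' \<circ> h) u) u" using dgh gh S base commute[of u "h u"] commute[of "h u" "g u"] by simp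
  qed (use gh g' h' maps comp[OF g'(1) gh(2)] comp[OF h'(1) gh(1)] in \<open>auto simp: o_def\<close>)
  have "(g u, h u) \<in> related u"
    using 1 2 3 4 related_sym[OF _ base] by (metis (no_types) comp_apply r_into_rtrancl rtrancl_trans)
  then show False using gh by blast
qed

text \<open>Being related is an equivalence relation, so x is unrelated to v or to v'. If y is
  related to x, it is unrelated to the same one, and u lies between unrelated points.\<close>

lemma unrelated_dichotomy:
  assumes "v \<in> S" "v' \<in> S" "(v, v') \<notin> related u" "x \<in> S" "y \<in> S"
  shows "\<delta> x v = \<delta> x u + \<delta> u v \<and> \<delta> y v = \<delta> y u + \<delta> u v \<or>
         \<delta> x v' = \<delta> x u + \<delta> u v' \<and> \<delta> y v' = \<delta> y u + \<delta> u v' \<or>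
         \<delta> x y = \<delta> x u + \<delta> u y"
proof (cases "(x, y) \<in> related u")
  case False
  then show ?thesis using unrelated_dist assms base by blast
next
  case xy: True
  have "(x, v) \<notin> related u \<or> (x, v') \<notin> related u"
    using assms related_sym[OF _ base] by (meson rtrancl_trans)
  moreover have "(z, w) \<notin> related u" if "(x, w) \<notin> related u" "z = x \<or> z = y" for z w
    using that xy by (meson rtrancl_trans)
  ultimately show ?thesis using unrelated_dist assms base by metis
qed

end

section \<open>Asymptotic cones\<close>

context cone_data
begin

definition seq_dist :: "(nat \<Rightarrow> 'a) \<Rightarrow> (nat \<Rightarrow> 'a) \<Rightarrow> real" where
  "seq_dist x y = Lim \<omega> (\<lambda>n. dist (x n) (y n) / d n)"

lemma seq_dist_eqI: "((\<lambda>n. dist (x n) (y n) / d n) \<longlongrightarrow> l) \<omega> \<Longrightarrow> seq_dist x y = l"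
  unfolding seq_dist_def by (rule tendsto_Lim[OF nontriv])

lemma tendsto_seq_dist:
  assumes "x \<in> cone_seqs e d" "y \<in> cone_seqs e d"
  shows "((\<lambda>n. dist (x n) (y n) / d n) \<longlongrightarrow> seq_dist x y) \<omega>"
proof -
  obtain l where l: "((\<lambda>n. dist (x n) (y n) / d n) \<longlongrightarrow> l) \<omega>"
    by (rule seq_dist_tendsto[OF assms])
  then show ?thesis using seq_dist_eqI[OF l] by simp
qed

lemma seq_dist_commute: "seq_dist x y = seq_dist y x"
  by (simp add: seq_dist_def dist_commute)

lemma seq_dist_refl: "seq_dist x x = 0"
  by (rule seq_dist_eqI) simp

lemma seq_dist_triangle:
  assumes "x \<in> cone_seqs e d" "y \<in> cone_seqs e d" "z \<in> cone_seqs e d"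
  shows "seq_dist x z \<le> seq_dist x y + seq_dist y z"
  by (rule tendsto_le[OF nontriv tendsto_add[OF tendsto_seq_dist tendsto_seq_dist] tendsto_seq_dist])
     (use assms dist_div_triangle in \<open>auto intro!: always_eventually\<close>)

lemma seq_dist_nonneg:
  assumes "x \<in> cone_seqs e d" "y \<in> cone_seqs e d"
  shows "0 \<le> seq_dist x y"
  using seq_dist_triangle[of x y x] seq_dist_refl[of x] seq_dist_commute[of x y] assms by simp

lemma cone_seqsI:
  assumes "\<And>n. dist (x n) (e n) \<le> B * d n"
  shows "x \<in> cone_seqs e d"
proof -
  have "dist (x n) (e n) / d n \<le> B" for n
    using assms[of n] d_pos[of n] by (simp add: pos_divide_le_eq)
  then show ?thesis
    unfolding cone_seqs_def bounded_iff using d_pos by (auto simp: less_imp_le intro!: exI[of _ B])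
qed

lemma cone_seqsE:
  assumes "x \<in> cone_seqs e d"
  obtains B where "0 \<le> B" "\<And>n. dist (x n) (e n) \<le> B * d n"
proof -
  obtain B where B: "\<And>n. \<bar>dist (x n) (e n) / d n\<bar> \<le> B"
    using assms unfolding cone_seqs_def bounded_iff by auto
  have "dist (x n) (e n) \<le> B * d n" for n
    using B[of n] d_pos[of n] by (simp add: pos_divide_le_eq)
  moreover have "0 \<le> B" using B[of 0] by linarith
  ultimately show ?thesis using that by blast
qed

definition cone_class :: "(nat \<Rightarrow> 'a) \<Rightarrow> (nat \<Rightarrow> 'a) set" where
  "cone_class x = cone_rel \<omega> e d `` {x}"

lemma cone_class_in: "x \<in> cone_seqs e d \<Longrightarrow> cone_class x \<in> cone_points \<omega> e d"
  unfolding cone_class_def cone_points_def by (rule quotientI)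

lemma self_in_cone_class: "x \<in> cone_seqs e d \<Longrightarrow> x \<in> cone_class x"
  unfolding cone_class_def by (rule equiv_class_self[OF equiv_cone_rel])

lemma cone_pointsE:
  assumes "A \<in> cone_points \<omega> e d"
  obtains x where "x \<in> cone_seqs e d" "A = cone_class x"
  using cone_points_cases[OF assms] that unfolding cone_class_def by blast

lemma cone_dist_class:
  assumes "x \<in> cone_seqs e d" "y \<in> cone_seqs e d"
  shows "cone_dist \<omega> e d (cone_class x) (cone_class y) = seq_dist x y"
  using seq_dist_eqI[OF tendsto_cone_dist[OF cone_class_in[OF assms(1)] cone_class_in[OF assms(2)]
      self_in_cone_class[OF assms(1)] self_in_cone_class[OF assms(2)]]] by simp

lemma cone_class_eq_iff:
  assumes "x \<in> cone_seqs e d" "y \<in> cone_seqs e d"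
  shows "cone_class x = cone_class y \<longleftrightarrow> seq_dist x y = 0"
  using Metric_space.zero[OF Metric_space_cone cone_class_in[OF assms(1)] cone_class_in[OF assms(2)]]
    cone_dist_class[OF assms] by simp

lemma mtopology_cone: "mtopology_of (asymptotic_cone \<omega> e d)
    = Metric_space.mtopology (cone_points \<omega> e d) (cone_dist \<omega> e d)"
  by (simp add: mtopology_of_def mspace_asymptotic_cone mdist_asymptotic_cone)

lemma topspace_cone: "topspace (mtopology_of (asymptotic_cone \<omega> e d)) = cone_points \<omega> e d"
  by (simp add: mspace_asymptotic_cone)

text \<open>The path is the limit of geodesics from x n to y n, parametrised proportionally to
  [0, 1] since their lengths vary with n. The additive equation will show which points it
  avoids.\<close>

lemma cone_path_exists:
  assumes geo: "geodesic_space TYPE('a)"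
    and x: "x \<in> cone_seqs e d" and y: "y \<in> cone_seqs e d"
  obtains g where "pathin (mtopology_of (asymptotic_cone \<omega> e d)) g"
    "g 0 = cone_class x" "g 1 = cone_class y"
    "\<And>t. t \<in> {0..1} \<Longrightarrow> \<exists>z\<in>cone_seqs e d. g t = cone_class z \<and> seq_dist x z + seq_dist z y = seq_dist x y"
proof -
  have "\<exists>\<gamma>. geodesic_on {0..dist (x n) (y n)} \<gamma> \<and> \<gamma> 0 = x n \<and> \<gamma> (dist (x n) (y n)) = y n" for n
    using geo unfolding geodesic_space_def geodesic_segment_def by metis
  then have "\<forall>n. \<exists>\<gamma>. geodesic_on {0..dist (x n) (y n)} \<gamma> \<and> \<gamma> 0 = x n \<and> \<gamma> (dist (x n) (y n)) = y n"
    by blast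
  from choice[OF this] obtain \<gamma> where \<gamma>: "\<And>n. geodesic_on {0..dist (x n) (y n)} (\<gamma> n)"
      "\<And>n. \<gamma> n 0 = x n" "\<And>n. \<gamma> n (dist (x n) (y n)) = y n"
    by blast
  define z where "z = (\<lambda>t n. \<gamma> n (t * dist (x n) (y n)))"
  have zd: "dist (z s n) (z t n) = \<bar>s - t\<bar> * dist (x n) (y n)" if "s \<in> {0..1}" "t \<in> {0..1}" for s t n
  proof -
    have "s * dist (x n) (y n) \<in> {0..dist (x n) (y n)}" "t * dist (x n) (y n) \<in> {0..dist (x n) (y n)}"
      using that by (auto simp: mult_left_le_one_le)
    then have "dist (z s n) (z t n) = \<bar>s * dist (x n) (y n) - t * dist (x n) (y n)\<bar>"
      using \<gamma>(1)[of n] unfolding z_def geodesic_on_def by blast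
    also have "\<dots> = \<bar>s - t\<bar> * dist (x n) (y n)"
      by (simp add: abs_mult flip: left_diff_distrib)
    finally show ?thesis .
  qed
  have z01: "z 0 = x" "z 1 = y" using \<gamma> by (auto simp: z_def)
  obtain Bx where Bx: "0 \<le> Bx" "\<And>n. dist (x n) (e n) \<le> Bx * d n" using cone_seqsE[OF x] by blast
  obtain By where By: "0 \<le> By" "\<And>n. dist (y n) (e n) \<le> By * d n" using cone_seqsE[OF y] by blast
  have zS: "z t \<in> cone_seqs e d" if "t \<in> {0..1}" for t
  proof (rule cone_seqsI)
    fix n
    have "dist (x n) (z t n) = t * dist (x n) (y n)"
      using zd[of 0 t n] that z01 by simp
    also have "\<dots> \<le> dist (x n) (y n)" using that by (simp add: mult_left_le_one_le)
    finally have "dist (z t n) (e n) \<le> dist (x n) (y n) + dist (x n) (e n)"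
      using dist_triangle[of "z t n" "e n" "x n"] by (simp add: dist_commute)
    also have "\<dots> \<le> 2 * dist (x n) (e n) + dist (y n) (e n)"
      using dist_triangle2[of "x n" "y n" "e n"] by simp
    also have "\<dots> \<le> (2 * Bx + By) * d n" using Bx(2)[of n] By(2)[of n] by (simp add: algebra_simps)
    finally show "dist (z t n) (e n) \<le> (2 * Bx + By) * d n" .
  qed
  have zD: "seq_dist (z s) (z t) = \<bar>s - t\<bar> * seq_dist x y" if "s \<in> {0..1}" "t \<in> {0..1}" for s t
  proof (rule seq_dist_eqI)
    have "((\<lambda>n. \<bar>s - t\<bar> * (dist (x n) (y n) / d n)) \<longlongrightarrow> \<bar>s - t\<bar> * seq_dist x y) \<omega>"
      by (intro tendsto_mult tendsto_const tendsto_seq_dist x y)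
    then show "((\<lambda>n. dist (z s n) (z t n) / d n) \<longlongrightarrow> \<bar>s - t\<bar> * seq_dist x y) \<omega>"
      using zd[OF that] by simp
  qed
  define g where "g = (\<lambda>t. cone_class (z t))"
  have "pathin (mtopology_of (asymptotic_cone \<omega> e d)) g"
    unfolding pathin_def mtopology_cone Metric_space.continuous_map_to_metric[OF Metric_space_cone]
  proof (intro ballI allI impI)
    fix t :: real and \<epsilon> :: real
    assume t: "t \<in> topspace (top_of_set {0..1})" and \<epsilon>: "0 < \<epsilon>"
    define r where "r = \<epsilon> / (seq_dist x y + 1)"
    have p: "0 < seq_dist x y + 1" using seq_dist_nonneg[OF x y] by simp
    have "0 < r" using p \<epsilon> by (simp add: r_def)
    show "\<exists>U. openin (top_of_set {0..1}) U \<and> t \<in> U \<and>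
      (\<forall>s\<in>U. g s \<in> Metric_space.mball (cone_points \<omega> e d) (cone_dist \<omega> e d) (g t) \<epsilon>)"
    proof (intro exI conjI ballI)
      show "openin (top_of_set {0..1}) ({0..1} \<inter> ball t r)" by (simp add: openin_open_Int)
      show "t \<in> {0..1} \<inter> ball t r" using t \<open>0 < r\<close> by simp
      fix s assume s: "s \<in> {0..1} \<inter> ball t r"
      have "\<bar>t - s\<bar> * seq_dist x y \<le> \<bar>t - s\<bar> * (seq_dist x y + 1)" by (intro mult_left_mono) auto
      also have "\<dots> < r * (seq_dist x y + 1)" using s p by (intro mult_strict_right_mono) (auto simp: dist_real_def)
      also have "\<dots> = \<epsilon>" using p by (simp add: r_def)
      finally show "g s \<in> Metric_space.mball (cone_points \<omega> e d) (cone_dist \<omega> e d) (g t) \<epsilon>"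
        using s t zD[of t s] zS[of s] zS[of t] cone_class_in cone_dist_class
        by (auto simp: Metric_space.in_mball[OF Metric_space_cone] g_def)
    qed
  qed
  moreover have "\<exists>z\<in>cone_seqs e d. g t = cone_class z \<and> seq_dist x z + seq_dist z y = seq_dist x y"
    if "t \<in> {0..1}" for t
    using zD[of 0 t] zD[of t 1] zS[OF that] that z01
    by (intro bexI[of _ "z t"]) (auto simp: g_def algebra_simps)
  ultimately show ?thesis using that z01 by (auto simp: g_def)
qed

lemma connected_space_cone:
  assumes "geodesic_space TYPE('a)"
  shows "connected_space (mtopology_of (asymptotic_cone \<omega> e d))"
proof (rule path_connected_imp_connected_space)
  show "path_connected_space (mtopology_of (asymptotic_cone \<omega> e d))"
    unfolding path_connected_space_def topspace_cone
  proof (intro ballI)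
    fix A B assume AB: "A \<in> cone_points \<omega> e d" "B \<in> cone_points \<omega> e d"
    obtain x where x: "x \<in> cone_seqs e d" "A = cone_class x" using cone_pointsE[OF AB(1)] by blast
    obtain y where y: "y \<in> cone_seqs e d" "B = cone_class y" using cone_pointsE[OF AB(2)] by blast
    show "\<exists>g. pathin (mtopology_of (asymptotic_cone \<omega> e d)) g \<and> g 0 = A \<and> g 1 = B"
    proof (rule cone_path_exists[OF assms x(1) y(1)])
      fix g assume "pathin (mtopology_of (asymptotic_cone \<omega> e d)) g" "g 0 = cone_class x" "g 1 = cone_class y"
      then show ?thesis using x(2) y(2) by (intro exI[of _ g]) simp
    qed
  qed
qed

text \<open>A limit geodesic between linked points cannot meet q. If any two points off q were
  related, the complement of the cut-point would therefore be path connected.\<close>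

lemma cut_point_unrelated:
  assumes geo: "geodesic_space TYPE('a)"
    and cut: "has_cut_point (asymptotic_cone \<omega> e d)"
  obtains q a b where "q \<in> cone_seqs e d" "a \<in> cone_seqs e d" "b \<in> cone_seqs e d"
    "0 < seq_dist a q" "0 < seq_dist b q" "(a, b) \<notin> (links seq_dist (cone_seqs e d) q)\<^sup>*"
proof (rule ccontr)
  note goal = that
  assume no: "\<not> thesis"
  let ?X = "mtopology_of (asymptotic_cone \<omega> e d)"
  obtain P where P: "cut_point ?X P" using cut by (auto simp: has_cut_point_def)
  then have "P \<in> cone_points \<omega> e d" by (simp add: cut_point_def mspace_asymptotic_cone)
  then obtain q where q: "q \<in> cone_seqs e d" "P = cone_class q" by (rule cone_pointsE)
  let ?Y = "subtopology ?X (topspace ?X - {P})"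
  have topY: "topspace ?Y = cone_points \<omega> e d - {P}" by (auto simp: mspace_asymptotic_cone)
  have pos: "0 < seq_dist x q \<longleftrightarrow> cone_class x \<noteq> P" if "x \<in> cone_seqs e d" for x
    using cone_class_eq_iff[OF that q(1)] seq_dist_nonneg[OF that q(1)] q(2) by auto
  have link: "path_component_of ?Y (cone_class x) (cone_class y)"
    if "(x, y) \<in> links seq_dist (cone_seqs e d) q" for x y
  proof -
    have xy: "x \<in> cone_seqs e d" "y \<in> cone_seqs e d" "seq_dist x y < seq_dist x q + seq_dist q y"
      using that by (auto simp: links_def)
    obtain g where g: "pathin ?X g" "g 0 = cone_class x" "g 1 = cone_class y"
      "\<And>t. t \<in> {0..1} \<Longrightarrow> \<exists>z\<in>cone_seqs e d. g t = cone_class z \<and> seq_dist x z + seq_dist z y = seq_dist x y"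
      using cone_path_exists[OF geo xy(1,2)] by blast
    have "g t \<in> cone_points \<omega> e d - {P}" if t: "t \<in> {0..1}" for t
    proof -
      obtain z where z: "z \<in> cone_seqs e d" "g t = cone_class z" "seq_dist x z + seq_dist z y = seq_dist x y"
        using g(4)[OF t] by blast
      have "seq_dist z q \<noteq> 0"
        using seq_dist_triangle[of x z q] seq_dist_triangle[of q z y] seq_dist_commute[of q z] xy z q
        by auto
      then show ?thesis using z q cone_class_in cone_class_eq_iff by auto
    qed
    then have "pathin ?Y g" using g(1) by (simp add: pathin_subtopology mspace_asymptotic_cone)
    then show ?thesis using g(2,3) unfolding path_component_of_def by blast
  qed
  have related: "path_component_of ?Y (cone_class x) (cone_class y)"
    if "(x, y) \<in> (links seq_dist (cone_seqs e d) q)\<^sup>*" "x \<in> cone_seqs e d" "0 < seq_dist x q" for x y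
    using that(1)
  proof induction
    case base
    show ?case unfolding path_component_of_refl topY
      using cone_class_in[OF that(2)] pos[OF that(2)] that(3) by blast
  next
    case (step y z)
    show ?case by (rule path_component_of_trans[OF step.IH link[OF step.hyps(2)]])
  qed
  have "path_connected_space ?Y"
    unfolding path_connected_space_iff_path_component topY
  proof (intro ballI)
    fix A B assume AB: "A \<in> cone_points \<omega> e d - {P}" "B \<in> cone_points \<omega> e d - {P}"
    obtain a where a: "a \<in> cone_seqs e d" "A = cone_class a" using AB(1) by (blast elim: cone_pointsE)
    obtain b where b: "b \<in> cone_seqs e d" "B = cone_class b" using AB(2) by (blast elim: cone_pointsE)
    have "0 < seq_dist a q" "0 < seq_dist b q" using a b AB pos by auto
    then have "(a, b) \<in> (links seq_dist (cone_seqs e d) q)\<^sup>*"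
      using no goal[OF q(1) a(1) b(1)] by blast
    then show "path_component_of ?Y A B" using related a b \<open>0 < seq_dist a q\<close> by simp
  qed
  then have "connected_space ?Y" by (rule path_connected_imp_connected_space)
  then show False using P by (simp add: cut_point_def)
qed

end

section \<open>Gated sequences\<close>

text \<open>This is the separation property of an orbit without the isometry behind it:
  \<open>\<alpha>\<close> is the gain per step, \<open>D\<close> bounds the step length,
  \<open>c\<close> and \<open>E\<close> are slope and error of the separation.\<close>

locale gated_sequence =
  fixes p :: "int \<Rightarrow> 'a::metric_space" and \<alpha> c D E :: real
  assumes pos: "0 < \<alpha>" "0 < c" "c \<le> 1" "0 \<le> E"
    and step: "\<And>i. dist (p i) (p (i + 1)) \<le> D"
    and forward_or_backward: "\<And>x i. dist x (p i) + \<alpha> \<le> dist x (p (i + 1)) \<or> dist x (p i) + \<alpha> \<le> dist x (p (i - 1))"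
    and separation: "\<And>x y i.
      (dist x (p i) + \<alpha> \<le> dist x (p (i + 1)) \<and> dist y (p i) + \<alpha> \<le> dist y (p (i + 1))) \<or>
      (dist x (p i) + \<alpha> \<le> dist x (p (i - 1)) \<and> dist y (p i) + \<alpha> \<le> dist y (p (i - 1))) \<or>
      c * (dist x (p i) + dist y (p i)) - E \<le> dist x y"
begin

section \<open>Gates and contraction\<close>

definition fwd :: "'a \<Rightarrow> int \<Rightarrow> bool" where
  "fwd x i \<longleftrightarrow> dist x (p i) + \<alpha> \<le> dist x (p (i + 1))"

definition bwd :: "'a \<Rightarrow> int \<Rightarrow> bool" where
  "bwd x i \<longleftrightarrow> dist x (p i) + \<alpha> \<le> dist x (p (i - 1))"

text \<open>The step from i to i + 1 leads away from x, so stepping back from i + 1 cannot, and only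
  the forward alternative is left there.\<close>

lemma fwd_Suc: "fwd x (i + 1)" if "fwd x i"
proof -
  have "\<not> bwd x (i + 1)" using that pos by (simp add: fwd_def bwd_def)
  then show ?thesis using forward_or_backward[of x "i + 1"] by (auto simp: fwd_def bwd_def)
qed

lemma fwd_mono: "fwd x j" if "fwd x i" "i \<le> j"
  using that(2,1) by (induction j rule: int_ge_induct) (auto intro: fwd_Suc)

lemma bwd_if_not_fwd: "\<not> fwd x i \<Longrightarrow> bwd x i"
  using forward_or_backward[of x i] by (auto simp: fwd_def bwd_def)

lemma dist_ge_of_fwd:
  assumes "\<And>l. i \<le> l \<Longrightarrow> l < i + int n \<Longrightarrow> fwd x l"
  shows "dist x (p i) + \<alpha> * n \<le> dist x (p (i + int n))"
  using assms
proof (induction n)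
  case (Suc n)
  have "dist x (p i) + \<alpha> * n \<le> dist x (p (i + int n))" using Suc by simp
  moreover have "fwd x (i + int n)" using Suc.prems by simp
  ultimately show ?case by (simp add: fwd_def algebra_simps)
qed simp

lemma dist_ge_of_bwd:
  assumes "\<And>l. l \<le> i \<Longrightarrow> i - int n < l \<Longrightarrow> bwd x l"
  shows "dist x (p i) + \<alpha> * n \<le> dist x (p (i - int n))"
  using assms
proof (induction n)
  case (Suc n)
  have "dist x (p i) + \<alpha> * n \<le> dist x (p (i - int n))" using Suc by simp
  moreover have "bwd x (i - int n)" using Suc.prems by simp
  ultimately show ?case by (simp add: bwd_def algebra_simps)
qed simp

text \<open>If all indices were of one kind, the distance to x would drop by at least
  \<open>\<alpha>\<close> with each step in one direction and become negative.\<close>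

lemma threshold_exists: "\<exists>k. fwd x k \<and> \<not> fwd x (k - 1)"
proof -
  have "\<exists>k. fwd x k"
  proof (rule ccontr)
    assume "\<nexists>k. fwd x k"
    then have b: "\<And>l. bwd x l" using bwd_if_not_fwd by blast
    obtain n :: nat where n: "dist x (p 0) < \<alpha> * n"
      using pos reals_Archimedean3[of \<alpha>] by (metis mult.commute)
    have "dist x (p (int n)) + \<alpha> * n \<le> dist x (p (int n - int n))" using b by (intro dist_ge_of_bwd)
    then have "dist x (p (int n)) + \<alpha> * n \<le> dist x (p 0)" by simp
    then show False using n zero_le_dist[of x "p (int n)"] by linarith
  qed
  then obtain k0 where k0: "fwd x k0" by blast
  have "\<exists>k. \<not> fwd x k"
  proof (rule ccontr)
    assume "\<nexists>k. \<not> fwd x k"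
    then have b: "\<And>l. fwd x l" by blast
    obtain n :: nat where n: "dist x (p 0) < \<alpha> * n"
      using pos reals_Archimedean3[of \<alpha>] by (metis mult.commute)
    have "dist x (p (- int n)) + \<alpha> * n \<le> dist x (p (- int n + int n))" using b by (intro dist_ge_of_fwd)
    then have "dist x (p (- int n)) + \<alpha> * n \<le> dist x (p 0)" by simp
    then show False using n zero_le_dist[of x "p (- int n)"] by linarith
  qed
  then obtain k1 where k1: "\<not> fwd x k1" by blast
  have "k1 < k0" using k0 k1 fwd_mono by (meson linorder_not_le)
  then have "fwd x (k1 + int (nat (k0 - k1)))" using k0 by simp
  then have ex: "\<exists>n. fwd x (k1 + int n)" by blast
  define n where "n = (LEAST n. fwd x (k1 + int n))"
  have n: "fwd x (k1 + int n)" unfolding n_def by (rule LeastI_ex[OF ex])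
  have "n \<noteq> 0" using n k1 by (metis add.right_neutral of_nat_0)
  then have "\<not> fwd x (k1 + int (n - 1))"
    unfolding n_def by (intro not_less_Least) simp
  with n \<open>n \<noteq> 0\<close> show ?thesis by (intro exI[of _ "k1 + int n"]) (simp add: of_nat_diff add_diff_eq)
qed

text \<open>A coarse nearest-point projection; the switching index is unique because
  \<open>fwd\<close> is monotone.\<close>

definition gate :: "'a \<Rightarrow> int" where
  "gate x = (SOME k. fwd x k \<and> \<not> fwd x (k - 1))"

lemma fwd_iff: "fwd x i \<longleftrightarrow> gate x \<le> i"
proof -
  have g: "fwd x (gate x)" "\<not> fwd x (gate x - 1)"
    using someI_ex[OF threshold_exists[of x]] by (auto simp: gate_def)
  show ?thesis
  proof
    assume "fwd x i"
    then show "gate x \<le> i" using g(2) fwd_mono[of x i "gate x - 1"] by linarith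
  qed (use g fwd_mono in blast)
qed

lemma bwd_gate: "i < gate x \<Longrightarrow> bwd x i"
  by (simp add: bwd_if_not_fwd fwd_iff)

lemma bwd_le_gate: "bwd x i \<Longrightarrow> i \<le> gate x"
proof (rule ccontr)
  assume "bwd x i" "\<not> i \<le> gate x"
  then have "fwd x (i - 1)" by (simp add: fwd_iff)
  with \<open>bwd x i\<close> show False using pos by (simp add: fwd_def bwd_def)
qed

definition height :: "'a \<Rightarrow> real" where
  "height x = dist x (p (gate x))"

lemma D_pos: "0 < D"
proof -
  have "dist (p 0) (p 0) + \<alpha> \<le> dist (p 0) (p (0 + 1)) \<or> dist (p 0) (p 0) + \<alpha> \<le> dist (p 0) (p (0 - 1))"
    by (rule forward_or_backward)
  then show ?thesis using step[of 0] step[of "-1"] pos by (auto simp: dist_commute)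
qed

text \<open>The gate is almost a nearest point. On its left, distances are known to grow only from
  \<open>gate x - 1\<close> on, and this one step costs D.\<close>

lemma height_le_dist: "height x \<le> dist x (p j) + D"
proof (cases "gate x \<le> j")
  case True
  then have "dist x (p (gate x)) + \<alpha> * nat (j - gate x) \<le> dist x (p (gate x + int (nat (j - gate x))))"
    by (intro dist_ge_of_fwd) (simp add: fwd_iff)
  then have "height x \<le> dist x (p j)" using True pos
    by (auto simp: height_def intro: order_trans[rotated])
  then show ?thesis using D_pos by simp
next
  case False
  have "dist x (p (gate x - 1)) + \<alpha> * nat (gate x - 1 - j)
      \<le> dist x (p (gate x - 1 - int (nat (gate x - 1 - j))))"
    by (intro dist_ge_of_bwd) (simp add: bwd_gate)
  then have "dist x (p (gate x - 1)) \<le> dist x (p j)" using False pos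
    by (auto intro: order_trans[rotated])
  moreover have "dist x (p (gate x)) \<le> dist x (p (gate x - 1)) + D"
    using dist_triangle[of x "p (gate x)" "p (gate x - 1)"] step[of "gate x - 1"] by simp
  ultimately show ?thesis by (simp add: height_def)
qed

text \<open>At such an m, \<open>bwd\<close> is excluded for x and \<open>fwd\<close> for y, so
  neither of the first two alternatives of \<open>separation\<close> can hold.\<close>

lemma separation_between:
  assumes "gate x < m" "m < gate y"
  shows "c * (dist x (p m) + dist y (p m)) - E \<le> dist x y"
proof -
  have "\<not> bwd x m" using assms bwd_le_gate[of x m] by linarith
  moreover have "\<not> fwd y m" using assms by (simp add: fwd_iff)
  ultimately show ?thesis using separation[of x m y] by (auto simp: fwd_def bwd_def)
qed

text \<open>Gates that differ by 2 or more leave room for an index strictly between them. The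
  distances to it are at least the heights up to D, and c <= 1 keeps the total error at 2 D.\<close>

lemma contraction:
  assumes "2 \<le> \<bar>gate x - gate y\<bar>"
  shows "c * (height x + height y) - (E + 2 * D) \<le> dist x y"
proof -
  obtain m where m: "c * (dist x (p m) + dist y (p m)) - E \<le> dist x y"
  proof (cases "gate x < gate y")
    case True
    then show ?thesis using that separation_between[of x "gate x + 1" y] assms by simp
  next
    case False
    then show ?thesis using that separation_between[of y "gate y + 1" x] assms
      by (simp add: dist_commute add.commute)
  qed
  have "c * (height x + height y) \<le> c * (dist x (p m) + dist y (p m) + 2 * D)"
    using height_le_dist[of x m] height_le_dist[of y m] pos by (intro mult_left_mono) auto
  also have "\<dots> = c * (dist x (p m) + dist y (p m)) + c * (2 * D)" by (simp add: algebra_simps)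
  also have "c * (2 * D) \<le> 1 * (2 * D)" using pos D_pos by (intro mult_right_mono) auto
  finally show ?thesis using m by linarith
qed

section \<open>The sequence as a quasi-geodesic and the gate as a coarse Lipschitz map\<close>

lemma dist_p_le: "dist (p i) (p j) \<le> D * \<bar>i - j\<bar>"
proof -
  have *: "dist (p i) (p (i + int n)) \<le> D * n" for i n
  proof (induction n)
    case (Suc n)
    then show ?case using step[of "i + int n"] dist_triangle[of "p i" "p (i + int (Suc n))" "p (i + int n)"]
      by (simp add: algebra_simps)
  qed simp
  show ?thesis
    using *[of i "nat (j - i)"] *[of j "nat (i - j)"]
    by (cases "i \<le> j") (auto simp: dist_commute)
qed

lemma gate_p_le: "gate (p i) \<le> i + 1"
proof (rule ccontr)
  assume n: "\<not> gate (p i) \<le> i + 1"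
  define m where "m = nat (gate (p i) - 1 - i)"
  have "dist (p i) (p (gate (p i) - 1)) + \<alpha> * m \<le> dist (p i) (p (gate (p i) - 1 - int m))"
    by (intro dist_ge_of_bwd) (simp add: bwd_gate)
  then have "dist (p i) (p (gate (p i) - 1)) + \<alpha> * m \<le> 0" using n by (simp add: m_def)
  moreover have "0 < \<alpha> * m" using n pos by (simp add: m_def)
  ultimately show False using zero_le_dist[of "p i" "p (gate (p i) - 1)"] by linarith
qed

text \<open>Seen from \<open>p i\<close> the gate is at most i + 1, so the distance grows linearly
  from there on; this costs the term -1.\<close>

lemma dist_p_ge: "\<alpha> * (\<bar>i - j\<bar> - 1) \<le> dist (p i) (p j)"
proof -
  have *: "\<alpha> * n \<le> dist (p i) (p (i + 1 + int n))" for i n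
  proof -
    have "dist (p i) (p (i + 1)) + \<alpha> * n \<le> dist (p i) (p (i + 1 + int n))"
      using gate_p_le[of i] by (intro dist_ge_of_fwd) (auto simp: fwd_iff)
    then show ?thesis using zero_le_dist[of "p i" "p (i + 1)"] by linarith
  qed
  consider "i = j" | "i < j" | "j < i" by linarith
  then show ?thesis
  proof cases
    case 1 then show ?thesis using pos by simp
  next
    case 2 then show ?thesis using *[of "nat (j - i - 1)" i] by simp
  next
    case 3 then show ?thesis using *[of "nat (i - j - 1)" j] by (simp add: dist_commute)
  qed
qed

text \<open>When the gates differ by at least 2, contraction bounds both heights by d(x, y). Hence
  the gate points are close, and by \<open>dist_p_ge\<close> so are their indices.\<close>

lemma gate_lipschitz:
  obtains A B where "0 \<le> A" "0 \<le> B" "\<And>x y. \<bar>real_of_int (gate x) - gate y\<bar> \<le> A * dist x y + B"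
proof -
  define A where "A = (1 / c + 1) / \<alpha>"
  define B where "B = (E + 2 * D) / c / \<alpha> + 2"
  have AB: "0 \<le> A" "2 \<le> B" using pos D_pos by (auto simp: A_def B_def)
  have "\<bar>real_of_int (gate x) - gate y\<bar> \<le> A * dist x y + B" for x y
  proof (cases "2 \<le> \<bar>gate x - gate y\<bar>")
    case True
    have "c * (height x + height y) \<le> dist x y + (E + 2 * D)"
      using contraction[OF True] by simp
    then have h: "height x + height y \<le> (dist x y + (E + 2 * D)) / c"
      using pos by (simp add: field_simps)
    have "\<alpha> * (\<bar>real_of_int (gate x) - gate y\<bar> - 1) \<le> dist (p (gate x)) (p (gate y))"
      using dist_p_ge[of "gate x" "gate y"] by simp
    also have "\<dots> \<le> dist x y + (height x + height y)"
      using dist_triangle[of "p (gate x)" "p (gate y)" x] dist_triangle[of x "p (gate y)" y]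
      by (simp add: height_def dist_commute)
    finally have "\<alpha> * (\<bar>real_of_int (gate x) - gate y\<bar> - 1) \<le> dist x y + (dist x y + (E + 2 * D)) / c"
      using h by linarith
    then have "\<bar>real_of_int (gate x) - gate y\<bar> - 1 \<le> (dist x y + (dist x y + (E + 2 * D)) / c) / \<alpha>"
      using pos by (simp add: field_simps)
    also have "\<dots> = A * dist x y + (B - 2)"
      using pos by (simp add: A_def B_def field_simps)
    finally show ?thesis by simp
  next
    case False
    then have "\<bar>real_of_int (gate x) - gate y\<bar> \<le> 2" by linarith
    moreover have "0 \<le> A * dist x y" using AB by simp
    ultimately show ?thesis using AB by linarith
  qed
  then show ?thesis using that[of A B] AB by simp
qed


section \<open>Quasi-geodesics near a gated sequence\<close>

text \<open>Above height H, contraction lets a step of this size change the gate by at most 1. The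
  walk stops when it first comes down to H.\<close>

lemma gate_walk:
  assumes steps: "\<And>i. dist (x i) (x (Suc i)) < c * H - (E + 2 * D)"
    and "height (x N) \<le> H"
  obtains n where "height (x n) \<le> H" "\<bar>gate (x 0) - gate (x n)\<bar> \<le> int n" "\<And>i. i < n \<Longrightarrow> H < height (x i)"
proof -
  define n where "n = (LEAST n. height (x n) \<le> H)"
  have n: "height (x n) \<le> H" unfolding n_def using assms(2) by (rule LeastI)
  have less: "H < height (x i)" if "i < n" for i
    using not_less_Least that unfolding n_def by fastforce
  have "i \<le> n \<Longrightarrow> \<bar>gate (x 0) - gate (x i)\<bar> \<le> int i" for i
  proof (induction i)
    case (Suc i)
    have "\<not> 2 \<le> \<bar>gate (x i) - gate (x (Suc i))\<bar>"
    proof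
      assume "2 \<le> \<bar>gate (x i) - gate (x (Suc i))\<bar>"
      then have "c * (height (x i) + height (x (Suc i))) - (E + 2 * D) \<le> dist (x i) (x (Suc i))"
        by (rule contraction)
      moreover have "c * H \<le> c * (height (x i) + height (x (Suc i)))"
        using less[of i] Suc.prems pos by (intro mult_left_mono) (auto simp: height_def add_increasing2)
      ultimately show False using steps[of i] by linarith
    qed
    with Suc show ?case by simp
  qed simp
  then show ?thesis using that n less by blast
qed

text \<open>Above height H the gate moves by at most one index, hence by at most D, per time
  \<open>\<tau>\<close>: this is speed 1 / (2 L). A quasi-geodesic separates its ends at speed 1 /
  L, so excursions above H last at most W.\<close>

lemma morse:
  assumes "1 \<le> L" "0 \<le> C" "0 \<le> r"
  shows "\<exists>M. \<forall>a b f. quasi_geodesic L C a b f \<and> (\<exists>i. dist (f a) (p i) \<le> r) \<and> (\<exists>i. dist (f b) (p i) \<le> r) \<longrightarrow>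
           (\<forall>t\<in>{a..b}. \<exists>i. dist (f t) (p i) \<le> M)"
proof -
  define \<tau> where "\<tau> = 2 * L * D"
  have \<tau>: "0 < \<tau>" using assms D_pos by (simp add: \<tau>_def)
  \<comment> \<open>H is so large that points within r of the sequence have height at most H and
    that steps of duration \<open>\<tau>\<close> are short enough for
    \<open>gate_walk\<close>.\<close>
  define H where "H = max (r + D) ((L * \<tau> + C + (E + 2 * D) + 1) / c)"
  have "(L * \<tau> + C + (E + 2 * D) + 1) / c \<le> H" by (simp add: H_def)
  then have "L * \<tau> + C + (E + 2 * D) + 1 \<le> H * c"
    using pos by (simp only: pos_divide_le_eq)
  then have H: "L * \<tau> + C < c * H - (E + 2 * D)" by (simp add: mult.commute)
  have rH: "height x \<le> H" if "dist x (p i) \<le> r" for x i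
    using height_le_dist[of x i] that by (simp add: H_def)
  define W where "W = 2 * L * (C + 2 * H + 2 * D)"
  have "\<exists>i. dist (f u) (p i) \<le> H + L * W + C"
    if qg: "quasi_geodesic L C a b f" and ea: "dist (f a) (p ia) \<le> r" and eb: "dist (f b) (p ib) \<le> r"
      and u: "u \<in> {a..b}" for a b f u ia ib
  proof -
    have lower: "\<bar>s - t\<bar> / L - C \<le> dist (f s) (f t)" and upper: "dist (f s) (f t) \<le> L * \<bar>s - t\<bar> + C"
      if "s \<in> {a..b}" "t \<in> {a..b}" for s t
      using qg that by (auto simp: quasi_geodesic_def)
    have small: "dist (f s) (f t) < c * H - (E + 2 * D)" if "s \<in> {a..b}" "t \<in> {a..b}" "\<bar>s - t\<bar> \<le> \<tau>" for s t
    proof -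
      have "L * \<bar>s - t\<bar> \<le> L * \<tau>" using that assms by (intro mult_left_mono) auto
      then show ?thesis using upper[of s t] that H by linarith
    qed
    obtain N :: nat where N: "b - a < N * \<tau>"
      using reals_Archimedean3[OF \<tau>] by blast
    \<comment> \<open>Two walks from time u in steps of \<open>\<tau>\<close>, to the left and to
      the right, clamped at the ends of the interval, where the height is at most H.\<close>
    define v where "v = (\<lambda>i::nat. max a (u - i * \<tau>))"
    define w where "w = (\<lambda>i::nat. min b (u + i * \<tau>))"
    have vN: "v N = a" and wN: "w N = b" using N u by (auto simp: v_def w_def)
    have \<tau>n: "0 \<le> real i * \<tau>" for i using \<tau> by simp
    have vw: "v i \<in> {a..b}" "w i \<in> {a..b}" for i using u \<tau>n[of i] by (auto simp: v_def w_def)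
    have vstep: "\<bar>v i - v (Suc i)\<bar> \<le> \<tau>" and wstep: "\<bar>w i - w (Suc i)\<bar> \<le> \<tau>" for i
      using \<tau> by (auto simp: v_def w_def algebra_simps max_def min_def)
    have uvw: "v i \<le> u" "u \<le> w i" for i using u \<tau>n[of i] by (auto simp: v_def w_def)
    have "height (f (v N)) \<le> H" "height (f (w N)) \<le> H" using vN wN rH ea eb by auto
    obtain n where n: "height (f (v n)) \<le> H" "\<bar>gate (f (v 0)) - gate (f (v n))\<bar> \<le> int n"
        "\<And>i. i < n \<Longrightarrow> H < height (f (v i))"
      using gate_walk[of "\<lambda>i. f (v i)" H N] small[OF vw(1) vw(1) vstep] \<open>height (f (v N)) \<le> H\<close> by blast
    obtain m where m: "height (f (w m)) \<le> H" "\<bar>gate (f (w 0)) - gate (f (w m))\<bar> \<le> int m"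
        "\<And>i. i < m \<Longrightarrow> H < height (f (w i))"
      using gate_walk[of "\<lambda>i. f (w i)" H N] small[OF vw(2) vw(2) wstep] \<open>height (f (w N)) \<le> H\<close> by blast
    \<comment> \<open>The walk is not clamped before it stops, because the height at a is at most H.
      Only its last step may be shorter than \<open>\<tau>\<close>, whence n - 1.\<close>
    have nv: "(real n - 1) * \<tau> \<le> u - v n"
    proof (cases n)
      case 0 then show ?thesis using uvw(1)[of n] \<tau> by simp
    next
      case (Suc l)
      have "v l \<noteq> a" using n(3)[of l] rH[OF ea] Suc by auto
      then have "v l = u - l * \<tau>" by (auto simp: v_def max_def split: if_splits)
      moreover have "v n \<le> v l" using \<tau> Suc by (auto simp: v_def algebra_simps)
      ultimately show ?thesis using Suc by simp
    qed
    have mw: "(real m - 1) * \<tau> \<le> w m - u"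
    proof (cases m)
      case 0 then show ?thesis using uvw(2)[of m] \<tau> by simp
    next
      case (Suc l)
      have "w l \<noteq> b" using m(3)[of l] rH[OF eb] Suc by auto
      then have "w l = u + l * \<tau>" by (auto simp: w_def min_def split: if_splits)
      moreover have "w l \<le> w m" using \<tau> Suc by (auto simp: w_def algebra_simps)
      ultimately show ?thesis using Suc by simp
    qed
    define s where "s = v n"
    define t where "t = w m"
    have st: "s \<in> {a..b}" "t \<in> {a..b}" "s \<le> u" "u \<le> t" using vw uvw by (auto simp: s_def t_def)
    have "v 0 = u" "w 0 = u" using u by (auto simp: v_def w_def)
    then have g: "\<bar>gate (f s) - gate (f t)\<bar> \<le> int n + int m" using n(2) m(2) by (simp add: s_def t_def)
    have "dist (p (gate (f s))) (p (gate (f t))) \<le> D * \<bar>gate (f s) - gate (f t)\<bar>" by (rule dist_p_le)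
    also have "\<dots> \<le> D * (real n + real m)"
    proof (intro mult_left_mono)
      show "real_of_int \<bar>gate (f s) - gate (f t)\<bar> \<le> real n + real m" using g by linarith
    qed (use D_pos in simp)
    also have "\<dots> \<le> D * ((t - s) / \<tau> + 2)"
    proof (intro mult_left_mono)
      have "(real n + real m - 2) * \<tau> \<le> t - s" using nv mw by (simp add: s_def t_def algebra_simps)
      then have "real n + real m - 2 \<le> (t - s) / \<tau>" using \<tau> by (simp only: pos_le_divide_eq)
      then show "real n + real m \<le> (t - s) / \<tau> + 2" by simp
    qed (use D_pos in simp)
    also have "\<dots> = (t - s) / (2 * L) + 2 * D" using assms D_pos by (simp add: \<tau>_def field_simps)
    finally have pd: "dist (p (gate (f s))) (p (gate (f t))) \<le> (t - s) / (2 * L) + 2 * D" .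
    have hh: "dist (f s) (p (gate (f s))) \<le> H" "dist (f t) (p (gate (f t))) \<le> H"
      using n(1) m(1) by (simp_all add: height_def s_def t_def)
    have "(t - s) / L - C \<le> dist (f s) (f t)" using lower[of s t] st by simp
    also have "\<dots> \<le> dist (f s) (p (gate (f s))) + dist (p (gate (f s))) (p (gate (f t))) + dist (f t) (p (gate (f t)))"
      using dist_triangle[of "f s" "f t" "p (gate (f s))"] dist_triangle2[of "p (gate (f s))" "f t" "p (gate (f t))"]
      by linarith
    finally have "(t - s) / L - C \<le> 2 * H + (t - s) / (2 * L) + 2 * D" using hh pd by linarith
    moreover have "(t - s) / L = 2 * ((t - s) / (2 * L))" using assms by (simp add: field_simps)
    ultimately have "(t - s) / (2 * L) \<le> C + 2 * H + 2 * D" by linarith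
    then have "t - s \<le> W" using assms by (simp add: W_def field_simps)
    then have "L * \<bar>u - s\<bar> \<le> L * W" using st assms by (intro mult_left_mono) auto
    then have "dist (f u) (p (gate (f s))) \<le> H + L * W + C"
      using upper[of u s] u st(1) hh(1) dist_triangle[of "f u" "p (gate (f s))" "f s"] by linarith
    then show ?thesis by blast
  qed
  then show ?thesis by blast
qed

end

section \<open>Axial isometries and cut points\<close>

locale axial_isometry = gated_sequence p \<alpha> c D E for p :: "int \<Rightarrow> 'a::metric_space" and \<alpha> c D E +
  fixes g :: "'a \<Rightarrow> 'a"
  assumes isometry: "g \<in> isometries" and shift: "p (i + 1) = g (p i)"
begin

lemma gate_image: "gate (g x) = gate x + 1"
proof -
  have "dist (g x) (p (i + 1)) = dist x (p i)" for i
    by (simp add: shift isometriesD[OF isometry])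
  from this this[of "_ + 1"] have "fwd (g x) (i + 1) \<longleftrightarrow> fwd x i" for i
    by (simp add: fwd_def)
  then have "gate (g x) \<le> i + 1 \<longleftrightarrow> gate x \<le> i" for i by (simp add: fwd_iff)
  from this[of "gate x"] this[of "gate (g x) - 1"] show ?thesis by simp
qed

lemma gate_zpow: "gate (zpow g i x) = gate x + i"
proof -
  have b: "bij g" using isometry isometriesD by blast
  show ?thesis
  proof (induction i rule: int_induct[where k = 0])
    case base
    then show ?case by (simp add: zpow_0)
  next
    case (step1 i)
    then show ?case by (simp add: zpow_Suc[OF b] gate_image)
  next
    case (step2 i)
    then show ?case using zpow_Suc[OF b, of "i - 1" x] gate_image[of "zpow g (i - 1) x"] by simp
  qed
qed

lemma zpow_p: "zpow g i (p 0) = p i"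
proof -
  have b: "bij g" using isometry isometriesD by blast
  show ?thesis
  proof (induction i rule: int_induct[where k = 0])
    case base
    then show ?case by (simp add: zpow_0)
  next
    case (step1 i)
    then show ?case by (simp add: zpow_Suc[OF b] shift)
  next
    case (step2 i)
    have "g (zpow g (i - 1) (p 0)) = g (p (i - 1))"
      using step2 zpow_Suc[OF b, of "i - 1" "p 0"] shift[of "i - 1"] by simp
    then show ?case using b by (simp add: bij_is_inj inj_eq)
  qed
qed

lemma displacement_pos: "0 < dist x (g x)"
proof -
  have "x \<noteq> g x"
  proof
    assume "x = g x"
    then have "gate x = gate (g x)" by (rule arg_cong)
    then show False by (simp add: gate_image)
  qed
  then show ?thesis by (rule zero_less_dist_iff[THEN iffD2])
qed

text \<open>A point far from the sequence is displaced a lot, because the geodesic to its image under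
  \<open>g\<^sup>2\<close> has to pass near the sequence.\<close>

lemma minimal_displacement_exists:
  assumes "proper_space TYPE('a)"
  obtains x where "\<And>y. dist x (g x) \<le> dist y (g y)"
proof -
  have b: "bij g" and gd: "\<And>x y. dist (g x) (g y) = dist x y"
    using isometry isometriesD by blast+
  define R where "R = (2 * dist (p 1) (g (p 1)) + E) / c"
  have "continuous_on (cball (p 1) R) g"
    using gd by (intro continuous_onI) auto
  then have "continuous_on (cball (p 1) R) (\<lambda>x. dist x (g x))"
    by (intro continuous_on_dist continuous_on_id)
  moreover have "compact (cball (p 1) R)" using assms by (simp add: proper_space_def)
  moreover have R0: "0 \<le> R" using pos by (simp add: R_def)
  ultimately obtain x where x: "x \<in> cball (p 1) R" "\<And>y. y \<in> cball (p 1) R \<Longrightarrow> dist x (g x) \<le> dist y (g y)"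
    using continuous_attains_inf[of "cball (p 1) R" "\<lambda>x. dist x (g x)"] by auto
  have "dist x (g x) \<le> dist y (g y)" for y
  proof (cases "dist (p 1) (g (p 1)) \<le> dist y (g y)")
    case True
    then show ?thesis using x(2)[of "p 1"] R0 by simp
  next
    case False
    \<comment> \<open>A power of g moves the gate to 0. Then g (g z) has gate 2 and index 1 lies
      strictly between, which g z would not allow. A displacement below that of \<open>p 1\<close>
      now forces z into the ball of radius R.\<close>
    define z where "z = zpow g (- gate y) y"
    have gz: "gate z = 0" by (simp add: z_def gate_zpow)
    have "g z = zpow g (- gate y) (g y)"
      unfolding z_def using zpow_Suc2[OF b, of "- gate y" y] zpow_Suc[OF b, of "- gate y" y] by metis
    then have dz: "dist z (g z) = dist y (g y)"
      by (simp add: z_def dist_zpow[OF isometry])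
    have "c * (dist z (p 1) + dist (g (g z)) (p 1)) - E \<le> dist z (g (g z))"
      by (rule separation_between) (simp_all add: gate_image gz)
    also have "\<dots> \<le> 2 * dist z (g z)"
      using dist_triangle[of z "g (g z)" "g z"] gd[of z "g z"] by simp
    finally have "c * (dist z (p 1) + dist (g (g z)) (p 1)) \<le> 2 * dist (p 1) (g (p 1)) + E"
      using False dz by simp
    moreover have "c * dist z (p 1) \<le> c * (dist z (p 1) + dist (g (g z)) (p 1))"
      using pos by (intro mult_left_mono) auto
    ultimately have "dist z (p 1) * c \<le> 2 * dist (p 1) (g (p 1)) + E" by (simp add: mult.commute)
    then have "dist (p 1) z \<le> R" using pos by (simp add: R_def pos_le_divide_eq dist_commute)
    then show ?thesis using x(2)[of z] dz by simp
  qed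
  then show ?thesis using that by blast
qed

text \<open>The axis runs through the orbit of a point x of minimal displacement, at distance r =
  d(x, \<open>p 0\<close>) from each \<open>p i\<close>; this bound transfers the Morse property
  from the sequence.\<close>

theorem periodic_morse_line_exists:
  assumes cat: "CAT0_space TYPE('a)" and "proper_space TYPE('a)"
  obtains \<gamma> :: "real \<Rightarrow> 'a" where "periodic_line \<gamma>" "morse_geodesic UNIV \<gamma>"
proof -
  obtain x where x: "\<And>y. dist x (g x) \<le> dist y (g y)"
    using minimal_displacement_exists assms by blast
  define T where "T = dist x (g x)"
  have T: "0 < T" unfolding T_def by (rule displacement_pos)
  have geo: "geodesic_space TYPE('a)" using cat by (simp add: CAT0_space_def)
  have orbit: "dist (zpow g i x) (zpow g j x) = \<bar>i - j\<bar> * T" for i j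
    unfolding T_def by (rule minimal_displacement_orbit[OF cat isometry x])
  obtain \<gamma> where \<gamma>: "geodesic_on UNIV \<gamma>" "\<And>t. g (\<gamma> t) = \<gamma> (t + T)" "\<And>i. \<gamma> (of_int i * T) = zpow g i x"
    using axis_exists[OF geo isometry T orbit] by blast
  have per: "periodic_line \<gamma>"
    unfolding periodic_line_def using \<gamma> T isometry by (metis less_irrefl)
  define r where "r = dist x (p 0)"
  have near: "dist (\<gamma> (of_int i * T)) (p i) = r" for i
    using \<gamma>(3) zpow_p[of i, symmetric] dist_zpow[OF isometry] by (simp add: r_def)
  have end_near: "\<exists>i. dist (\<gamma> t) (p i) \<le> r + T" for t
  proof -
    have "dist (\<gamma> t) (\<gamma> (of_int \<lfloor>t / T\<rfloor> * T)) = \<bar>t - of_int \<lfloor>t / T\<rfloor> * T\<bar>"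
      using geodesic_onD[OF \<gamma>(1)] by blast
    also have "\<dots> \<le> T"
      using floor_divide_lower[OF T, of t] floor_divide_upper[OF T, of t] by (simp add: algebra_simps)
    finally show ?thesis
      using near[of "\<lfloor>t / T\<rfloor>"] dist_triangle[of "\<gamma> t" "p \<lfloor>t / T\<rfloor>" "\<gamma> (of_int \<lfloor>t / T\<rfloor> * T)"]
      by (intro exI[of _ "\<lfloor>t / T\<rfloor>"]) simp
  qed
  have "morse_geodesic UNIV \<gamma>"
    unfolding morse_geodesic_def
  proof (intro conjI allI impI \<gamma>(1))
    fix L C :: real assume LC: "1 \<le> L \<and> 0 \<le> C"
    have "0 \<le> r + T" using T by (simp add: r_def)
    then obtain M where M: "\<And>a b f t. \<lbrakk>quasi_geodesic L C a b f; \<exists>i. dist (f a) (p i) \<le> r + T;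
        \<exists>i. dist (f b) (p i) \<le> r + T; t \<in> {a..b}\<rbrakk> \<Longrightarrow> \<exists>i. dist (f t) (p i) \<le> M"
      using morse[of L C "r + T"] LC by blast
    show "\<exists>M. \<forall>a b f. quasi_geodesic L C a b f \<and> f a \<in> range \<gamma> \<and> f b \<in> range \<gamma> \<longrightarrow>
           (\<forall>t\<in>{a..b}. \<exists>s\<in>UNIV. dist (f t) (\<gamma> s) \<le> M)"
    proof (intro exI allI impI ballI)
      fix a b f t
      assume f: "quasi_geodesic L C a b f \<and> f a \<in> range \<gamma> \<and> f b \<in> range \<gamma>" and t: "t \<in> {a..b}"
      then obtain sa sb where "f a = \<gamma> sa" "f b = \<gamma> sb" by blast
      then have "\<exists>i. dist (f a) (p i) \<le> r + T" "\<exists>i. dist (f b) (p i) \<le> r + T"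
        using end_near[of sa] end_near[of sb] by simp_all
      then obtain i where "dist (f t) (p i) \<le> M" using M[of a b f t] f t by blast
      then have "dist (f t) (\<gamma> (of_int i * T)) \<le> M + r"
        using near[of i] dist_triangle2[of "f t" "\<gamma> (of_int i * T)" "p i"] by linarith
      then show "\<exists>s\<in>UNIV. dist (f t) (\<gamma> s) \<le> M + r" by blast
    qed
  qed
  then show ?thesis using that per by blast
qed

end

section \<open>Coarse homogeneity, rescaled limits and cut-points in all cones\<close>

lemma cocompact_orbit_dense:
  assumes "cocompact_space TYPE('a::metric_space)"
  obtains R where "\<And>y::'a. \<exists>h\<in>isometries. dist (h b) y \<le> R"
proof -
  obtain K :: "'a set" where K: "compact K" "(\<Union>g\<in>isometries. g ` K) = UNIV"
    using assms by (auto simp: cocompact_space_def)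
  obtain R where R: "\<And>k. k \<in> K \<Longrightarrow> dist b k \<le> R"
    using compact_imp_bounded[OF K(1)] by (metis bounded_any_center)
  have "\<exists>h\<in>isometries. dist (h b) y \<le> R" for y
  proof -
    have "y \<in> (\<Union>g\<in>isometries. g ` K)" using K(2) by simp
    then obtain h k where "h \<in> isometries" "k \<in> K" "y = h k" by blast
    then show ?thesis using R by (intro bexI[of _ h]) (auto simp: isometriesD(2))
  qed
  then show ?thesis using that by blast
qed

context cone_data
begin

lemma eventually_d_ge: "eventually (\<lambda>n. b \<le> d n) \<omega>"
  using scaling by (simp add: scaling_sequence_def filterlim_at_top)

lemma tendsto_const_div_d: "((\<lambda>n. b / d n) \<longlongrightarrow> 0) \<omega>"
  using scaling by (intro tendsto_divide_0[OF tendsto_const] filterlim_at_top_imp_at_infinity)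
    (simp add: scaling_sequence_def)

text \<open>\<open>ultrafilter_bounded_tendsto\<close> wants a bound at every index, but quotients
  by \<open>d n\<close> are often controlled only where \<open>d n\<close> is not small. Resetting f
  to 0 elsewhere leaves the limit unchanged.\<close>

lemma eventually_bounded_tendsto:
  fixes f :: "nat \<Rightarrow> real"
  assumes "eventually (\<lambda>n. \<bar>f n\<bar> \<le> B) \<omega>"
  shows "(f \<longlongrightarrow> Lim \<omega> f) \<omega>"
proof -
  have "bounded (range (\<lambda>n. if \<bar>f n\<bar> \<le> B then f n else 0))"
    by (auto simp: bounded_iff intro!: exI[of _ "\<bar>B\<bar>"])
  then obtain l where "((\<lambda>n. if \<bar>f n\<bar> \<le> B then f n else 0) \<longlongrightarrow> l) \<omega>"
    using ultrafilter_bounded_tendsto[OF ultra] by blast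
  moreover have "eventually (\<lambda>n. (if \<bar>f n\<bar> \<le> B then f n else 0) = f n) \<omega>"
    using assms by eventually_elim simp
  ultimately have "(f \<longlongrightarrow> l) \<omega>" by (simp add: tendsto_cong)
  then show ?thesis using tendsto_Lim[OF nontriv] by metis
qed

text \<open>Openness is tested on representatives; the assumption includes
  \<open>seq_dist x y = 0\<close> and so makes Q independent of them.\<close>

lemma openin_cone:
  assumes "\<And>x. x \<in> cone_seqs e d \<Longrightarrow> Q x \<Longrightarrow> \<exists>r>0. \<forall>y\<in>cone_seqs e d. seq_dist x y < r \<longrightarrow> Q y"
  shows "openin (mtopology_of (asymptotic_cone \<omega> e d)) (cone_class ` {x \<in> cone_seqs e d. Q x})"
  unfolding mtopology_cone Metric_space.openin_mtopology[OF Metric_space_cone]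
proof (intro conjI allI impI)
  show "cone_class ` {x \<in> cone_seqs e d. Q x} \<subseteq> cone_points \<omega> e d" using cone_class_in by auto
  fix A assume "A \<in> cone_class ` {x \<in> cone_seqs e d. Q x}"
  then obtain x where x: "x \<in> cone_seqs e d" "Q x" "A = cone_class x" by blast
  then obtain r where r: "r > 0" "\<And>y. y \<in> cone_seqs e d \<Longrightarrow> seq_dist x y < r \<Longrightarrow> Q y"
    using assms by blast
  have "B \<in> cone_class ` {x \<in> cone_seqs e d. Q x}"
    if "B \<in> Metric_space.mball (cone_points \<omega> e d) (cone_dist \<omega> e d) A r" for B
  proof -
    have "B \<in> cone_points \<omega> e d" "cone_dist \<omega> e d A B < r"
      using that by (auto simp: Metric_space.in_mball[OF Metric_space_cone])
    moreover from this obtain y where "y \<in> cone_seqs e d" "B = cone_class y" using cone_pointsE by blast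
    ultimately show ?thesis using r x cone_dist_class by auto
  qed
  then show "\<exists>r>0. Metric_space.mball (cone_points \<omega> e d) (cone_dist \<omega> e d) A r
      \<subseteq> cone_class ` {x \<in> cone_seqs e d. Q x}"
    using r(1) by blast
qed

end

text \<open>The gate coordinate of a point, rescaled, passes to the limit. In the cone it is locally
  constant off the limit of the gated sequence, hence the base point separates its positive from
  its negative values.\<close>

theorem (in gated_sequence) has_cut_point_cone:
  fixes e :: "nat \<Rightarrow> 'a"
  assumes geo: "geodesic_space TYPE('a)" and coc: "cocompact_space TYPE('a)"
    and "nonprincipal_ultrafilter \<omega>" "scaling_sequence \<omega> d"
  shows "has_cut_point (asymptotic_cone \<omega> e d)"
proof -
  interpret cone_data \<omega> e d using assms by unfold_locales
  let ?S = "cone_seqs e d"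
  \<comment> \<open>The base points may wander: \<open>h n\<close> carries \<open>p 0\<close> to
    within R of \<open>e n\<close>, and \<open>pull\<close> undoes this so that one fixed gated
    sequence serves all n.\<close>
  obtain R where "\<And>y::'a. \<exists>h\<in>isometries. dist (h (p 0)) y \<le> R"
    using cocompact_orbit_dense[OF coc, of "p 0"] by blast
  then have "\<forall>n. \<exists>h. h \<in> isometries \<and> dist (h (p 0)) (e n) \<le> R" by blast
  from choice[OF this] obtain h where h: "\<And>n. h n \<in> isometries" "\<And>n. dist (h n (p 0)) (e n) \<le> R"
    by blast
  have R0: "0 \<le> R" using h(2)[of 0] zero_le_dist order_trans by blast
  define pull where "pull = (\<lambda>(x :: nat \<Rightarrow> 'a) n. inv (h n) (x n))"
  have pull_dist: "dist (pull x n) (pull y n) = dist (x n) (y n)" for x y n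
    using isometriesD(2)[OF isometries_inv[OF h(1)]] by (simp add: pull_def)
  have pull_h: "dist (pull x n) q = dist (x n) (h n q)" for x n q
    using isometriesD(2)[OF h(1)[of n], of "inv (h n) (x n)" q] isometriesD(1)[OF h(1)[of n]]
    by (simp add: pull_def bij_is_surj surj_f_inv_f)
  have pull_base: "\<bar>dist (pull x n) (p 0) - dist (x n) (e n)\<bar> \<le> R" for x n
    using h(2)[of n] dist_triangle[of "x n" "h n (p 0)" "e n"] dist_triangle[of "x n" "e n" "h n (p 0)"]
      dist_commute[of "e n" "h n (p 0)"]
    by (simp add: pull_h)
  obtain A B where AB: "0 \<le> A" "0 \<le> B" "\<And>x y. \<bar>real_of_int (gate x) - gate y\<bar> \<le> A * dist x y + B"
    using gate_lipschitz by blast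
  define \<kappa> where "\<kappa> = (\<lambda>x. Lim \<omega> (\<lambda>n. gate (pull x n) / d n))"
  have \<kappa>: "((\<lambda>n. gate (pull x n) / d n) \<longlongrightarrow> \<kappa> x) \<omega>" if x: "x \<in> ?S" for x
  proof -
    obtain C where C: "0 \<le> C" "\<And>n. dist (x n) (e n) \<le> C * d n" using cone_seqsE[OF x] by blast
    define F where "F = A * R + B + \<bar>real_of_int (gate (p 0))\<bar>"
    have F: "0 \<le> F" using AB R0 by (simp add: F_def)
    show ?thesis
      unfolding \<kappa>_def
    proof (rule eventually_bounded_tendsto)
      show "\<forall>\<^sub>F n in \<omega>. \<bar>real_of_int (gate (pull x n)) / d n\<bar> \<le> A * C + F"
        using eventually_d_ge[of 1]
      proof eventually_elim
        case (elim n)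
        have "\<bar>real_of_int (gate (pull x n))\<bar> \<le> A * dist (pull x n) (p 0) + B + \<bar>real_of_int (gate (p 0))\<bar>"
          using AB(3)[of "pull x n" "p 0"] by linarith
        also have "\<dots> \<le> A * (C * d n + R) + B + \<bar>real_of_int (gate (p 0))\<bar>"
          using pull_base[of x n] C(2)[of n] AB(1) by (intro add_right_mono mult_left_mono) auto
        also have "\<dots> = A * C * d n + F * 1" by (simp add: F_def algebra_simps)
        also have "\<dots> \<le> A * C * d n + F * d n" using elim F by (intro add_left_mono mult_left_mono)
        also have "\<dots> = (A * C + F) * d n" by (simp add: algebra_simps)
        finally show ?case using d_pos[of n] by (simp add: abs_of_pos pos_divide_le_eq)
      qed
    qed
  qed
  have \<kappa>_lip: "\<bar>\<kappa> x - \<kappa> y\<bar> \<le> A * seq_dist x y" if xy: "x \<in> ?S" "y \<in> ?S" for x y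
  proof (rule tendsto_le[OF nontriv])
    show "((\<lambda>n. A * (dist (x n) (y n) / d n) + B / d n) \<longlongrightarrow> A * seq_dist x y) \<omega>"
      using tendsto_add[OF tendsto_mult[OF tendsto_const tendsto_seq_dist[OF xy]] tendsto_const_div_d[of B], of A]
      by simp
    show "((\<lambda>n. \<bar>gate (pull x n) / d n - gate (pull y n) / d n\<bar>) \<longlongrightarrow> \<bar>\<kappa> x - \<kappa> y\<bar>) \<omega>"
      by (intro tendsto_rabs tendsto_diff \<kappa> xy)
    have "\<bar>gate (pull x n) / d n - gate (pull y n) / d n\<bar> \<le> A * (dist (x n) (y n) / d n) + B / d n" for n
    proof -
      have "\<bar>gate (pull x n) / d n - gate (pull y n) / d n\<bar> = \<bar>real_of_int (gate (pull x n)) - gate (pull y n)\<bar> / d n"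
        using d_pos[of n] by (simp add: abs_of_pos flip: diff_divide_distrib)
      also have "\<dots> \<le> (A * dist (x n) (y n) + B) / d n"
        using AB(3)[of "pull x n" "pull y n"] d_pos[of n] by (intro divide_right_mono) (auto simp: pull_dist)
      finally show ?thesis by (simp add: add_divide_distrib)
    qed
    then show "\<forall>\<^sub>F n in \<omega>. \<bar>gate (pull x n) / d n - gate (pull y n) / d n\<bar> \<le> A * (dist (x n) (y n) / d n) + B / d n"
      by simp
  qed
  have eS: "e \<in> ?S" by (rule cone_seqsI[of _ 0]) simp
  \<comment> \<open>If \<open>\<kappa> x = 0\<close>, the gate of \<open>pull x n\<close> is
    o(\<open>d n\<close>), so its height is at least the distance to the base point up to
    o(\<open>d n\<close>). By contraction, points closer than c times this distance have their gates
    within 1.\<close>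
  have \<kappa>_const: "\<kappa> y = 0" if xy: "x \<in> ?S" "y \<in> ?S" and "\<kappa> x = 0" and close: "seq_dist x y < c * seq_dist x e" for x y
  proof -
    have "((\<lambda>n. c * (dist (x n) (e n) / d n - R / d n - D * \<bar>gate (pull x n) / d n\<bar>) - (E + 2 * D) / d n
        - dist (x n) (y n) / d n) \<longlongrightarrow> c * (seq_dist x e - 0 - D * \<bar>\<kappa> x\<bar>) - 0 - seq_dist x y) \<omega>"
      by (intro tendsto_intros tendsto_seq_dist tendsto_const_div_d \<kappa> xy eS)
    then have "\<forall>\<^sub>F n in \<omega>. 0 < c * (dist (x n) (e n) / d n - R / d n - D * \<bar>gate (pull x n) / d n\<bar>)
        - (E + 2 * D) / d n - dist (x n) (y n) / d n"
      using close \<open>\<kappa> x = 0\<close> by (intro order_tendstoD(1)) auto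
    then have ev: "\<forall>\<^sub>F n in \<omega>. \<bar>real_of_int (gate (pull x n)) - gate (pull y n)\<bar> \<le> 1"
    proof eventually_elim
      case (elim n)
      have "\<not> 2 \<le> \<bar>gate (pull x n) - gate (pull y n)\<bar>"
      proof
        assume "2 \<le> \<bar>gate (pull x n) - gate (pull y n)\<bar>"
        then have le: "c * (height (pull x n) + height (pull y n)) - (E + 2 * D) \<le> dist (x n) (y n)"
          using contraction[of "pull x n" "pull y n"] by (simp add: pull_dist)
        have "dist (x n) (e n) - R \<le> dist (pull x n) (p 0)" using pull_base[of x n] by linarith
        also have "\<dots> \<le> height (pull x n) + D * \<bar>gate (pull x n)\<bar>"
          using dist_triangle[of "pull x n" "p 0" "p (gate (pull x n))"] dist_p_le[of "gate (pull x n)" 0]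
          by (simp add: height_def)
        finally have "c * (dist (x n) (e n) - R - D * \<bar>gate (pull x n)\<bar>) \<le> c * (height (pull x n) + height (pull y n))"
          using pos by (intro mult_left_mono) (auto simp: height_def intro: add_increasing2)
        then have "c * (dist (x n) (e n) - R - D * \<bar>gate (pull x n)\<bar>) - (E + 2 * D) - dist (x n) (y n) \<le> 0"
          using le by linarith
        then have "(c * (dist (x n) (e n) - R - D * \<bar>gate (pull x n)\<bar>) - (E + 2 * D) - dist (x n) (y n)) / d n \<le> 0"
          using d_pos[of n] by (simp add: divide_nonpos_pos)
        moreover have "(c * (dist (x n) (e n) - R - D * \<bar>gate (pull x n)\<bar>) - (E + 2 * D) - dist (x n) (y n)) / d n
          = c * (dist (x n) (e n) / d n - R / d n - D * \<bar>gate (pull x n) / d n\<bar>) - (E + 2 * D) / d n - dist (x n) (y n) / d n"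
          using d_pos[of n] by (simp add: abs_of_pos diff_divide_distrib right_diff_distrib add_divide_distrib)
        ultimately show False using elim by linarith
      qed
      then show ?case by linarith
    qed
    have "((\<lambda>n. gate (pull x n) / d n - gate (pull y n) / d n) \<longlongrightarrow> 0) \<omega>"
    proof (rule Lim_null_comparison[OF _ tendsto_const_div_d[of 1]])
      show "\<forall>\<^sub>F n in \<omega>. norm (gate (pull x n) / d n - gate (pull y n) / d n) \<le> 1 / d n"
        using ev
      proof eventually_elim
        case (elim n)
        have "norm (gate (pull x n) / d n - gate (pull y n) / d n) = \<bar>real_of_int (gate (pull x n)) - gate (pull y n)\<bar> / d n"
          using d_pos[of n] by (simp add: abs_of_pos flip: diff_divide_distrib)
        also have "\<dots> \<le> 1 / d n" using elim d_pos[of n] by (intro divide_right_mono) auto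
        finally show ?case .
      qed
    qed
    then show ?thesis
      using tendsto_unique[OF nontriv _ tendsto_diff[OF \<kappa>[OF xy(1)] \<kappa>[OF xy(2)]]] \<open>\<kappa> x = 0\<close> by fastforce
  qed
  let ?X = "mtopology_of (asymptotic_cone \<omega> e d)"
  define P where "P = cone_class e"
  have PX: "P \<in> topspace ?X" using eS cone_class_in by (simp add: P_def mspace_asymptotic_cone)
  \<comment> \<open>The value 0 goes to one side only: near a point of V with
    \<open>\<kappa> x = 0\<close>, \<open>\<kappa>_const\<close> keeps the value 0, so V is
    open.\<close>
  define U where "U = cone_class ` {x \<in> ?S. 0 < seq_dist x e \<and> \<kappa> x < 0}"
  define V where "V = cone_class ` {x \<in> ?S. 0 < seq_dist x e \<and> 0 \<le> \<kappa> x}"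
  have off_base: "0 < seq_dist y e" if "x \<in> ?S" "y \<in> ?S" "seq_dist x y < seq_dist x e" for x y
    using seq_dist_triangle[of x y e] that eS by simp
  have off_zero: "\<bar>\<kappa> x - \<kappa> y\<bar> < \<bar>\<kappa> x\<bar>" if "x \<in> ?S" "y \<in> ?S" "seq_dist x y < \<bar>\<kappa> x\<bar> / (A + 1)" for x y
  proof -
    have "\<bar>\<kappa> x - \<kappa> y\<bar> \<le> A * seq_dist x y" using \<kappa>_lip that by simp
    also have "\<dots> \<le> (A + 1) * seq_dist x y"
      using AB seq_dist_nonneg[OF that(1,2)] by (intro mult_right_mono) auto
    also have "\<dots> < \<bar>\<kappa> x\<bar>" using that(3) AB by (simp add: pos_less_divide_eq mult.commute)
    finally show ?thesis .
  qed
  have radius_pos: "0 < \<bar>\<kappa> x\<bar> / (A + 1)" if "\<kappa> x \<noteq> 0" for x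
    using that AB(1) by (intro divide_pos_pos) auto
  have openU: "openin ?X U"
    unfolding U_def
  proof (rule openin_cone)
    fix x assume x: "x \<in> ?S" "0 < seq_dist x e \<and> \<kappa> x < 0"
    define r where "r = min (seq_dist x e) (\<bar>\<kappa> x\<bar> / (A + 1))"
    have "\<kappa> x \<noteq> 0" using x by simp
    then have "0 < r" unfolding r_def min_less_iff_conj using x radius_pos by blast
    moreover have "0 < seq_dist y e \<and> \<kappa> y < 0" if "y \<in> ?S" "seq_dist x y < r" for y
      using off_base[of x y] off_zero[of x y] x that by (auto simp: r_def)
    ultimately show "\<exists>r>0. \<forall>y\<in>?S. seq_dist x y < r \<longrightarrow> 0 < seq_dist y e \<and> \<kappa> y < 0" by blast
  qed
  have openV: "openin ?X V"
    unfolding V_def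
  proof (rule openin_cone)
    fix x assume x: "x \<in> ?S" "0 < seq_dist x e \<and> 0 \<le> \<kappa> x"
    define r where "r = (if \<kappa> x = 0 then c * seq_dist x e else min (seq_dist x e) (\<bar>\<kappa> x\<bar> / (A + 1)))"
    have "0 < r"
    proof (cases "\<kappa> x = 0")
      case True
      then show ?thesis using x pos by (simp add: r_def)
    next
      case False
      then show ?thesis using x radius_pos[OF False] by (simp add: r_def del: divide_less_0_iff zero_less_divide_iff zero_less_abs_iff)
    qed
    moreover have "0 < seq_dist y e \<and> 0 \<le> \<kappa> y" if y: "y \<in> ?S" "seq_dist x y < r" for y
    proof (cases "\<kappa> x = 0")
      case True
      then have lt: "seq_dist x y < c * seq_dist x e" using y by (simp add: r_def)
      also have "\<dots> \<le> 1 * seq_dist x e" using pos x by (intro mult_right_mono) auto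
      finally show ?thesis using off_base[of x y] \<kappa>_const[of x y] x y True lt by simp
    next
      case False
      then show ?thesis using off_base[of x y] off_zero[of x y] x y by (auto simp: r_def)
    qed
    ultimately show "\<exists>r>0. \<forall>y\<in>?S. seq_dist x y < r \<longrightarrow> 0 < seq_dist y e \<and> 0 \<le> \<kappa> y" by blast
  qed
  have disj: "U \<inter> V = {}"
  proof -
    have False if "x \<in> ?S" "y \<in> ?S" "cone_class x = cone_class y" "\<kappa> x < 0" "0 \<le> \<kappa> y" for x y
      using \<kappa>_lip[of x y] cone_class_eq_iff[of x y] that by simp
    then show ?thesis by (fastforce simp: U_def V_def)
  qed
  have cover: "topspace ?X - {P} = U \<union> V"
  proof -
    have "0 < seq_dist x e \<longleftrightarrow> cone_class x \<noteq> P" if "x \<in> ?S" for x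
      using cone_class_eq_iff[OF that eS] seq_dist_nonneg[OF that eS] by (auto simp: P_def)
    then have "cone_class ` ?S - {P} = cone_class ` {x \<in> ?S. 0 < seq_dist x e}" by blast
    moreover have "cone_points \<omega> e d = cone_class ` ?S"
      using cone_class_in by (blast elim: cone_pointsE)
    moreover have "{x \<in> ?S. 0 < seq_dist x e} =
        {x \<in> ?S. 0 < seq_dist x e \<and> \<kappa> x < 0} \<union> {x \<in> ?S. 0 < seq_dist x e \<and> 0 \<le> \<kappa> x}"
      using not_le by blast
    ultimately show ?thesis unfolding topspace_cone U_def V_def by (simp only: image_Un)
  qed
  \<comment> \<open>The gate point of \<open>p i\<close> is within D of \<open>p i\<close>, so by
    \<open>dist_p_ge\<close> the indices differ by at most D / \<open>\<alpha>\<close> + 1.\<close>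
  define F where "F = D / \<alpha> + 2"
  have gate_p: "\<bar>real_of_int (gate (p i)) - i\<bar> \<le> F - 1" for i
  proof -
    have "\<alpha> * (\<bar>real_of_int i - gate (p i)\<bar> - 1) \<le> dist (p i) (p (gate (p i)))"
      using dist_p_ge[of i "gate (p i)"] by simp
    also have "\<dots> \<le> D" using height_le_dist[of "p i" i] by (simp add: height_def)
    finally have "\<bar>real_of_int i - gate (p i)\<bar> - 1 \<le> D / \<alpha>" using pos by (simp add: pos_le_divide_eq mult.commute)
    then show ?thesis by (simp add: F_def abs_minus_commute)
  qed
  have \<kappa>e: "\<kappa> e = 0"
  proof -
    have "((\<lambda>n. gate (pull e n) / d n) \<longlongrightarrow> 0) \<omega>"
    proof (rule Lim_null_comparison[OF _ tendsto_const_div_d[of "A * R + B + \<bar>real_of_int (gate (p 0))\<bar>"]])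
      have "norm (gate (pull e n) / d n) \<le> (A * R + B + \<bar>real_of_int (gate (p 0))\<bar>) / d n" for n
      proof -
        have "A * dist (pull e n) (p 0) \<le> A * R" using pull_base[of e n] AB by (intro mult_left_mono) auto
        then have "\<bar>real_of_int (gate (pull e n))\<bar> \<le> A * R + B + \<bar>real_of_int (gate (p 0))\<bar>"
          using AB(3)[of "pull e n" "p 0"] by linarith
        then have "\<bar>real_of_int (gate (pull e n))\<bar> / d n \<le> (A * R + B + \<bar>real_of_int (gate (p 0))\<bar>) / d n"
          using d_pos[of n] by (intro divide_right_mono) auto
        then show ?thesis using d_pos[of n] by (simp add: abs_of_pos)
      qed
      then show "\<forall>\<^sub>F n in \<omega>. norm (gate (pull e n) / d n) \<le> (A * R + B + \<bar>real_of_int (gate (p 0))\<bar>) / d n"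
        by simp
    qed
    then show ?thesis using \<kappa>[OF eS] tendsto_unique[OF nontriv] by blast
  qed
  \<comment> \<open>Both sides are inhabited: sequence points with index about
    \<open>\<sigma> * d n\<close> have coordinate close to \<open>\<sigma>\<close>, and 1 / 2 leaves
    room for the error F.\<close>
  have far: "\<exists>x\<in>?S. 0 < seq_dist x e \<and> 1 / 2 \<le> \<sigma> * \<kappa> x" if \<sigma>: "\<sigma> = 1 \<or> \<sigma> = -1" for \<sigma> :: int
  proof -
    \<comment> \<open>\<open>cone_seqs\<close> requires a bound at every index; where
      \<open>d n\<close> is small, the base point provides it.\<close>
    define x where "x = (\<lambda>n. if 1 \<le> d n then h n (p (\<sigma> * \<lfloor>d n\<rfloor>)) else e n)"
    have xS: "x \<in> ?S"
    proof (rule cone_seqsI)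
      fix n
      show "dist (x n) (e n) \<le> (D + R) * d n"
      proof (cases "1 \<le> d n")
        case True
        have "dist (x n) (h n (p 0)) \<le> D * \<bar>real_of_int (\<sigma> * \<lfloor>d n\<rfloor>)\<bar>"
          using dist_p_le[of "\<sigma> * \<lfloor>d n\<rfloor>" 0] True by (simp add: x_def isometriesD(2)[OF h(1)])
        also have "\<bar>real_of_int (\<sigma> * \<lfloor>d n\<rfloor>)\<bar> \<le> d n" using \<sigma> True by (auto simp: abs_mult)
        finally have "dist (x n) (h n (p 0)) \<le> D * d n" using D_pos by simp
        moreover have "R * 1 \<le> R * d n" using True R0 by (intro mult_left_mono)
        ultimately show ?thesis
          using h(2)[of n] dist_triangle[of "x n" "e n" "h n (p 0)"] by (simp add: distrib_right)
      next
        case False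
        then show ?thesis using D_pos R0 d_pos[of n] by (simp add: x_def)
      qed
    qed
    have "1 / 2 \<le> \<sigma> * \<kappa> x"
    proof (rule tendsto_lowerbound[OF tendsto_mult[OF tendsto_const \<kappa>[OF xS]] _ nontriv])
      show "\<forall>\<^sub>F n in \<omega>. 1 / 2 \<le> \<sigma> * (gate (pull x n) / d n)"
        using eventually_d_ge[of "max 1 (2 * F)"]
      proof eventually_elim
        case (elim n)
        then have "pull x n = p (\<sigma> * \<lfloor>d n\<rfloor>)"
          using isometriesD(1)[OF h(1)[of n]] by (simp add: pull_def x_def bij_is_inj)
        then have "\<bar>real_of_int (gate (pull x n)) - \<sigma> * \<lfloor>d n\<rfloor>\<bar> \<le> F - 1"
          using gate_p[of "\<sigma> * \<lfloor>d n\<rfloor>"] by simp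
        then have "d n - F \<le> \<sigma> * gate (pull x n)"
          using \<sigma> by (auto simp: abs_le_iff) linarith+
        then have "1 / 2 * d n \<le> \<sigma> * gate (pull x n)" using elim by simp
        then show ?case using d_pos[of n] by (simp add: pos_le_divide_eq)
      qed
    qed
    moreover have "0 < seq_dist x e"
    proof (rule ccontr)
      assume "\<not> 0 < seq_dist x e"
      then have "seq_dist x e = 0" using seq_dist_nonneg[OF xS eS] by simp
      then have "\<kappa> x = 0" using \<kappa>_lip[OF xS eS] \<kappa>e by simp
      then show False using \<open>1 / 2 \<le> \<sigma> * \<kappa> x\<close> by simp
    qed
    ultimately show ?thesis using xS by blast
  qed
  have "U \<noteq> {}" using far[of "-1"] by (force simp: U_def)
  moreover have "V \<noteq> {}" using far[of 1] by (force simp: V_def)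
  moreover have "U \<subseteq> topspace ?X - {P}" "V \<subseteq> topspace ?X - {P}" using cover by auto
  then have "openin (subtopology ?X (topspace ?X - {P})) U" "openin (subtopology ?X (topspace ?X - {P})) V"
    using openU openV by (auto intro: openin_subset_topspace_eq openin_open_subtopology simp: openin_subtopology_alt)
  moreover have "topspace (subtopology ?X (topspace ?X - {P})) \<subseteq> U \<union> V"
    using cover by (simp only: topspace_subtopology) blast
  ultimately have "\<not> connected_space (subtopology ?X (topspace ?X - {P}))"
    unfolding connected_space_def using disj by blast
  then have "cut_point ?X P"
    using PX connected_space_cone[OF geo] unfolding cut_point_def by blast
  then show ?thesis by (auto simp: has_cut_point_def)
qed

section \<open>From the cut point to an axial isometry\<close>

text \<open>In the cone \<open>unrelated_dichotomy\<close> holds with equalities. The slack D / 4 in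
  each alternative makes it hold in X for almost all n: otherwise counterexamples in the balls would
  form two points of the cone that violate it.\<close>

lemma (in cone_data) local_separation_of_cut_point:
  assumes geo: "geodesic_space TYPE('a)" and coc: "cocompact_space TYPE('a)"
    and const: "e = (\<lambda>_. b)" and cut: "has_cut_point (asymptotic_cone \<omega> e d)"
  obtains g D where "g \<in> isometries" "0 < D" "dist b (g b) = D"
    "\<And>x y. \<lbrakk>dist b x \<le> D; dist b y \<le> D\<rbrakk> \<Longrightarrow>
      dist b x + 3 / 4 * D \<le> dist x (g b) \<and> dist b y + 3 / 4 * D \<le> dist y (g b) \<or>
      dist b x + 3 / 4 * D \<le> dist x (inv g b) \<and> dist b y + 3 / 4 * D \<le> dist y (inv g b) \<or>
      dist b x + dist b y - D / 4 \<le> dist x y"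
proof -
  let ?S = "cone_seqs e d"
  \<comment> \<open>Sequences of isometries moving the base point by O(\<open>d n\<close>) are those
    that act on the cone.\<close>
  define G where "G = {\<phi>. \<exists>g::nat \<Rightarrow> 'a \<Rightarrow> 'a. (\<forall>n. g n \<in> isometries) \<and> (\<lambda>n. g n b) \<in> ?S \<and> \<phi> = (\<lambda>x n. g n (x n))}"
  obtain R where R: "\<And>y::'a. \<exists>h\<in>isometries. dist (h b) y \<le> R"
    using cocompact_orbit_dense[OF coc, of b] by blast
  then have R0: "0 \<le> R" using zero_le_dist order_trans by blast
  have eS: "e \<in> ?S" by (rule cone_seqsI[of _ 0]) simp
  have move: "(\<lambda>n. g n (x n)) \<in> ?S" if g: "\<And>n. g n \<in> isometries" "(\<lambda>n. g n b) \<in> ?S" and x: "x \<in> ?S" for g x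
  proof -
    obtain B where B: "0 \<le> B" "\<And>n. dist (g n b) (e n) \<le> B * d n" using cone_seqsE[OF g(2)] by blast
    obtain C where C: "0 \<le> C" "\<And>n. dist (x n) (e n) \<le> C * d n" using cone_seqsE[OF x] by blast
    have "dist (g n (x n)) (e n) \<le> (C + B) * d n" for n
      using B(2)[of n] C(2)[of n] dist_triangle[of "g n (x n)" "e n" "g n b"] isometriesD(2)[OF g(1)[of n], of "x n" b]
      by (simp add: const distrib_right)
    then show ?thesis by (rule cone_seqsI)
  qed
  interpret homogeneous_pseudometric ?S seq_dist G e
  proof
    show "seq_dist x x = 0" for x by (rule seq_dist_refl)
    show "seq_dist x y = seq_dist y x" for x y by (rule seq_dist_commute)
    show "seq_dist x z \<le> seq_dist x y + seq_dist y z" if "x \<in> ?S" "y \<in> ?S" "z \<in> ?S" for x y z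
      using that by (rule seq_dist_triangle)
    show "e \<in> ?S" by (rule eS)
    show "\<phi> x \<in> ?S" if "\<phi> \<in> G" "x \<in> ?S" for \<phi> x
      using that move by (auto simp: G_def)
    show "seq_dist (\<phi> x) (\<phi> y) = seq_dist x y" if "\<phi> \<in> G" for \<phi> x y
      using that by (auto simp: G_def seq_dist_def isometriesD(2))
    show "\<phi> \<circ> \<psi> \<in> G" if \<phi>\<psi>: "\<phi> \<in> G" "\<psi> \<in> G" for \<phi> \<psi>
    proof -
      obtain g h where g: "\<And>n. g n \<in> isometries" "(\<lambda>n. g n b) \<in> ?S" "\<phi> = (\<lambda>x n. g n (x n))"
        and h: "\<And>n. h n \<in> isometries" "(\<lambda>n. h n b) \<in> ?S" "\<psi> = (\<lambda>x n. h n (x n))"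
        using \<phi>\<psi> by (auto simp: G_def)
      have "(\<lambda>n. (g n \<circ> h n) b) \<in> ?S" using move[OF g(1,2) h(2)] by simp
      then show ?thesis
        using g h isometries_comp unfolding G_def by (intro CollectI exI[of _ "\<lambda>n. g n \<circ> h n"]) auto
    qed
    show "\<exists>\<psi>\<in>G. \<forall>x\<in>?S. \<psi> (\<phi> x) = x \<and> \<phi> (\<psi> x) = x" if \<phi>: "\<phi> \<in> G" for \<phi>
    proof -
      obtain g where g: "\<And>n. g n \<in> isometries" "(\<lambda>n. g n b) \<in> ?S" "\<phi> = (\<lambda>x n. g n (x n))"
        using \<phi> by (auto simp: G_def)
      have b: "bij (g n)" for n using g isometriesD by blast
      have "dist (inv (g n) b) (e n) = dist (g n b) (e n)" for n
        using isometriesD(2)[OF g(1)[of n], of "inv (g n) b" b] b[of n]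
        by (simp add: const bij_is_surj surj_f_inv_f dist_commute)
      then have "(\<lambda>n. inv (g n) b) \<in> ?S" using g(2) by (simp add: cone_seqs_def)
      then have "(\<lambda>x n. inv (g n) (x n)) \<in> G"
        unfolding G_def
        by (intro CollectI exI[of _ "\<lambda>n. inv (g n)"]) (simp add: g(1) isometries_inv)
      then show ?thesis
        using g(3) b by (intro bexI[of _ "\<lambda>x n. inv (g n) (x n)"]) (auto simp: bij_is_surj surj_f_inv_f bij_is_inj)
    qed
    show "\<exists>\<phi>\<in>G. seq_dist x (\<phi> e) = 0" if x: "x \<in> ?S" for x
    proof -
      have "\<forall>n. \<exists>h. h \<in> isometries \<and> dist (h b) (x n) \<le> R" using R by blast
      from choice[OF this] obtain h where h: "\<And>n. h n \<in> isometries" "\<And>n. dist (h n b) (x n) \<le> R"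
        by blast
      obtain C where C: "0 \<le> C" "\<And>n. dist (x n) (e n) \<le> C * d n" using cone_seqsE[OF x] by blast
      \<comment> \<open>The error R is O(\<open>d n\<close>) only where \<open>d n\<close> is
        bounded below; elsewhere the identity keeps the sequence in G.\<close>
      define g where "g = (\<lambda>n. if 1 \<le> d n then h n else id)"
      have iso: "g n \<in> isometries" for n
        using h isometries_funpow[OF h(1), of 0] by (simp add: g_def)
      have S: "(\<lambda>n. g n b) \<in> ?S"
      proof (rule cone_seqsI)
        fix n
        show "dist (g n b) (e n) \<le> (R + C) * d n"
        proof (cases "1 \<le> d n")
          case True
          then have "R * 1 \<le> R * d n" using R0 by (intro mult_left_mono)
          then show ?thesis using True h(2)[of n] C(2)[of n] dist_triangle[of "h n b" "e n" "x n"]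
            by (simp add: g_def distrib_right)
        next
          case False
          then show ?thesis using R0 C d_pos[of n] by (simp add: g_def const)
        qed
      qed
      have "((\<lambda>n. dist (x n) (g n b) / d n) \<longlongrightarrow> 0) \<omega>"
      proof (rule Lim_null_comparison[OF _ tendsto_const_div_d[of R]])
        show "\<forall>\<^sub>F n in \<omega>. norm (dist (x n) (g n b) / d n) \<le> R / d n"
          using eventually_d_ge[of 1]
        proof eventually_elim
          case (elim n)
          then have "dist (x n) (g n b) \<le> R" using h(2)[of n] by (simp add: g_def dist_commute)
          then show ?case using d_pos[of n] by (simp add: divide_right_mono)
        qed
      qed
      then have "seq_dist x (\<lambda>n. g n (e n)) = 0" using seq_dist_eqI by (simp add: const)
      moreover have "(\<lambda>x n. g n (x n)) \<in> G" using iso S by (auto simp: G_def)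
      ultimately show ?thesis by (intro bexI[of _ "\<lambda>x n. g n (x n)"])
    qed
  qed
  obtain q u v where "q \<in> ?S" "u \<in> ?S" "v \<in> ?S" "0 < seq_dist u q" "0 < seq_dist v q" "(u, v) \<notin> related q"
    using cut_point_unrelated[OF geo cut] by blast
  then obtain \<phi> \<psi> where \<phi>\<psi>: "\<phi> \<in> G" "\<psi> \<in> G" "\<And>x. x \<in> ?S \<Longrightarrow> \<psi> (\<phi> x) = x \<and> \<phi> (\<psi> x) = x"
      "0 < seq_dist (\<phi> e) e" "(\<phi> e, \<psi> e) \<notin> related e"
    using axial_element_exists by metis
  obtain g where g: "\<And>n. g n \<in> isometries" "(\<lambda>n. g n b) \<in> ?S" "\<phi> = (\<lambda>x n. g n (x n))"
    using \<phi>\<psi>(1) by (auto simp: G_def)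
  have bij: "bij (g n)" for n using g isometriesD by blast
  \<comment> \<open>\<open>\<psi>\<close> is known only as an inverse of \<open>\<phi>\<close> on
    cone sequences, but this fixes its value at the base sequence pointwise.\<close>
  have \<psi>e: "\<psi> e n = inv (g n) b" for n
  proof -
    have "g n (\<psi> e n) = b" using \<phi>\<psi>(3)[OF eS] g(3) by (metis const)
    then show ?thesis using bij[of n] by (metis bij_inv_eq_iff)
  qed
  have \<phi>e: "\<phi> e n = g n b" for n using g(3) by (simp add: const)
  have S: "\<phi> e \<in> ?S" "\<psi> e \<in> ?S" using maps \<phi>\<psi> eS by auto
  define D where "D = (\<lambda>n. dist b (g n b))"
  define l where "l = seq_dist (\<phi> e) e"
  have l: "0 < l" using \<phi>\<psi> by (simp add: l_def)
  have "seq_dist e (\<psi> e) = seq_dist (\<phi> e) (\<phi> (\<psi> e))" using preserves \<phi>\<psi>(1) eS S by metis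
  then have l': "seq_dist e (\<phi> e) = l" "seq_dist e (\<psi> e) = l"
    using \<phi>\<psi>(3)[OF eS] seq_dist_commute by (simp_all add: l_def)
  have Dlim: "((\<lambda>n. D n / d n) \<longlongrightarrow> l) \<omega>"
    using tendsto_seq_dist[OF eS S(1)] unfolding l' \<phi>e D_def by (simp add: const)
  define good where "good = (\<lambda>n x y.
      dist b x + 3 / 4 * D n \<le> dist x (g n b) \<and> dist b y + 3 / 4 * D n \<le> dist y (g n b) \<or>
      dist b x + 3 / 4 * D n \<le> dist x (inv (g n) b) \<and> dist b y + 3 / 4 * D n \<le> dist y (inv (g n) b) \<or>
      dist b x + dist b y - D n / 4 \<le> dist x y)"
  have "\<forall>n. \<exists>z. (\<exists>x y. dist b x \<le> D n \<and> dist b y \<le> D n \<and> \<not> good n x y) \<longrightarrow>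
      dist b (fst z) \<le> D n \<and> dist b (snd z) \<le> D n \<and> \<not> good n (fst z) (snd z)"
    by (metis fst_conv snd_conv)
  then obtain z where z: "\<And>n x y. \<lbrakk>dist b x \<le> D n; dist b y \<le> D n; \<not> good n x y\<rbrakk> \<Longrightarrow>
      dist b (fst (z n)) \<le> D n \<and> dist b (snd (z n)) \<le> D n \<and> \<not> good n (fst (z n)) (snd (z n))"
    by metis
  \<comment> \<open>Where no counterexample exists, \<open>z n\<close> is arbitrary; the default b
    keeps x and y in the ball at every n and hence in the cone.\<close>
  define x where "x = (\<lambda>n. if dist b (fst (z n)) \<le> D n then fst (z n) else b)"
  define y where "y = (\<lambda>n. if dist b (snd (z n)) \<le> D n then snd (z n) else b)"
  obtain B where B: "0 \<le> B" "\<And>n. dist (g n b) (e n) \<le> B * d n" using cone_seqsE[OF g(2)] by blast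
  have xyS: "x \<in> ?S" "y \<in> ?S"
  proof -
    have D: "D n \<le> B * d n" for n using B(2)[of n] by (simp add: D_def const dist_commute)
    have "dist (x n) (e n) \<le> D n" "dist (y n) (e n) \<le> D n" for n
      by (simp_all add: x_def y_def const dist_commute) (simp_all add: D_def)
    then show "x \<in> ?S" "y \<in> ?S" using D by (auto intro!: cone_seqsI[of _ B] intro: order_trans)
  qed
  have lim: "((\<lambda>n. dist b (u n) / d n) \<longlongrightarrow> seq_dist u e) \<omega>" if "u \<in> ?S" for u
    using tendsto_seq_dist[OF that eS] by (simp add: const dist_commute)
  have ev_far: "\<forall>\<^sub>F n in \<omega>. dist b (u n) + 3 / 4 * D n \<le> dist (u n) (w n)"
    if "u \<in> ?S" "w \<in> ?S" "seq_dist u w = seq_dist u e + l" for u w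
  proof -
    have "((\<lambda>n. dist (u n) (w n) / d n - dist b (u n) / d n - 3 / 4 * (D n / d n)) \<longlongrightarrow>
        seq_dist u w - seq_dist u e - 3 / 4 * l) \<omega>"
      by (intro tendsto_diff tendsto_mult tendsto_const tendsto_seq_dist lim Dlim that)
    then have "\<forall>\<^sub>F n in \<omega>. 0 < dist (u n) (w n) / d n - dist b (u n) / d n - 3 / 4 * (D n / d n)"
      by (rule order_tendstoD(1)) (use that(3) l in simp)
    then show ?thesis
    proof eventually_elim
      case (elim n)
      then have "0 < (dist (u n) (w n) - dist b (u n) - 3 / 4 * D n) / d n"
        by (simp add: diff_divide_distrib)
      then show ?case using d_pos[of n] by (simp add: zero_less_divide_iff)
    qed
  qed
  have "\<forall>\<^sub>F n in \<omega>. good n (x n) (y n)"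
  proof -
    consider "seq_dist x (\<phi> e) = seq_dist x e + l \<and> seq_dist y (\<phi> e) = seq_dist y e + l"
      | "seq_dist x (\<psi> e) = seq_dist x e + l \<and> seq_dist y (\<psi> e) = seq_dist y e + l"
      | "seq_dist x y = seq_dist x e + seq_dist e y"
      using unrelated_dichotomy[OF S \<phi>\<psi>(5) xyS] l' by auto
    then show ?thesis
    proof cases
      case 1
      then have "\<forall>\<^sub>F n in \<omega>. dist b (x n) + 3 / 4 * D n \<le> dist (x n) (\<phi> e n)"
        "\<forall>\<^sub>F n in \<omega>. dist b (y n) + 3 / 4 * D n \<le> dist (y n) (\<phi> e n)"
        using ev_far xyS S by auto
      then show ?thesis by eventually_elim (simp add: good_def \<phi>e)
    next
      case 2
      then have "\<forall>\<^sub>F n in \<omega>. dist b (x n) + 3 / 4 * D n \<le> dist (x n) (\<psi> e n)"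
        "\<forall>\<^sub>F n in \<omega>. dist b (y n) + 3 / 4 * D n \<le> dist (y n) (\<psi> e n)"
        using ev_far xyS S by auto
      then show ?thesis by eventually_elim (simp add: good_def \<psi>e)
    next
      case 3
      have "((\<lambda>n. dist (x n) (y n) / d n - dist b (x n) / d n - dist b (y n) / d n + 1 / 4 * (D n / d n)) \<longlongrightarrow>
          seq_dist x y - seq_dist x e - seq_dist y e + 1 / 4 * l) \<omega>"
        by (intro tendsto_add tendsto_diff tendsto_mult tendsto_const tendsto_seq_dist lim Dlim xyS)
      then have "\<forall>\<^sub>F n in \<omega>. 0 < dist (x n) (y n) / d n - dist b (x n) / d n - dist b (y n) / d n + 1 / 4 * (D n / d n)"
        by (rule order_tendstoD(1)) (use 3 l seq_dist_commute[of e y] in simp)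
      then show ?thesis
      proof eventually_elim
        case (elim n)
        then have "0 < (dist (x n) (y n) - dist b (x n) - dist b (y n) + 1 / 4 * D n) / d n"
          by (simp add: diff_divide_distrib add_divide_distrib)
        then show ?case using d_pos[of n] by (simp add: good_def zero_less_divide_iff)
      qed
    qed
  qed
  moreover have "\<forall>\<^sub>F n in \<omega>. 0 < D n / d n" using Dlim l by (rule order_tendstoD(1))
  ultimately have "\<forall>\<^sub>F n in \<omega>. good n (x n) (y n) \<and> 0 < D n / d n" by (rule eventually_conj)
  then obtain n where n: "good n (x n) (y n)" "0 < D n / d n"
    using eventually_happens nontriv by blast
  have "good n x' y'" if "dist b x' \<le> D n" "dist b y' \<le> D n" for x' y'
  proof (rule ccontr)
    assume "\<not> good n x' y'"
    from z[OF that this] n(1) show False by (simp add: x_def y_def)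
  qed
  moreover have "0 < D n" using n(2) d_pos[of n] by (simp add: zero_less_divide_iff)
  ultimately show ?thesis using that[of "g n" "D n"] g(1) unfolding good_def D_def by blast
qed

text \<open>\<open>zpow g (- i)\<close> carries the i-th orbit point to b and its neighbours to g b
  and inv g b, so the globalised separation at b serves all i.\<close>

lemma axial_isometry_of_local_separation:
  fixes b :: "'a::metric_space"
  assumes cat: "CAT0_space TYPE('a)" and g: "g \<in> isometries" and D: "0 < D" "dist b (g b) = D"
    and loc: "\<And>x y. \<lbrakk>dist b x \<le> D; dist b y \<le> D\<rbrakk> \<Longrightarrow>
      dist b x + 3 / 4 * D \<le> dist x (g b) \<and> dist b y + 3 / 4 * D \<le> dist y (g b) \<or>
      dist b x + 3 / 4 * D \<le> dist x (inv g b) \<and> dist b y + 3 / 4 * D \<le> dist y (inv g b) \<or>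
      dist b x + dist b y - D / 4 \<le> dist x y"
  shows "axial_isometry (\<lambda>i. zpow g i b) (D / 2) (1 / 2) D D g"
proof -
  have bij: "bij g" using g isometriesD by blast
  have "dist b (inv g b) = D"
    using isometriesD(2)[OF g, of "inv g b" b] D bij by (simp add: bij_is_surj surj_f_inv_f dist_commute)
  note glob = separation_local_to_global[OF cat D this loc]
  have pull: "dist x (zpow g i y) = dist (zpow g (- i) x) y" for x y i
    using dist_zpow[OF g, of "- i" x "zpow g i y"] inv_zpow[OF bij] by simp
  have prev: "zpow g (i - 1) b = zpow g i (inv g b)" for i
    using zpow_Suc2[OF bij, of "i - 1" "inv g b"] bij by (simp add: bij_is_surj surj_f_inv_f)
  have step: "dist (zpow g i b) (zpow g (i + 1) b) = D" for i
    using dist_zpow[OF g, of i b "g b"] D by (simp add: zpow_Suc2[OF bij])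
  show ?thesis
  proof
    show "dist (zpow g i b) (zpow g (i + 1) b) \<le> D" for i by (simp add: step)
    show "dist x (zpow g i b) + D / 2 \<le> dist x (zpow g (i + 1) b) \<or>
        dist x (zpow g i b) + D / 2 \<le> dist x (zpow g (i - 1) b)" for x i
      unfolding prev zpow_Suc2[OF bij] pull using glob(2)[of "zpow g (- i) x"] by (simp add: dist_commute)
    show "dist x (zpow g i b) + D / 2 \<le> dist x (zpow g (i + 1) b) \<and>
        dist y (zpow g i b) + D / 2 \<le> dist y (zpow g (i + 1) b) \<or>
        dist x (zpow g i b) + D / 2 \<le> dist x (zpow g (i - 1) b) \<and>
        dist y (zpow g i b) + D / 2 \<le> dist y (zpow g (i - 1) b) \<or>
        1 / 2 * (dist x (zpow g i b) + dist y (zpow g i b)) - D \<le> dist x y" for x y i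
      unfolding prev zpow_Suc2[OF bij] pull
      using glob(1)[of "zpow g (- i) x" "zpow g (- i) y"] dist_zpow[OF g, of "- i" x y]
      by (simp add: dist_commute)
    show "zpow g (i + 1) b = g (zpow g i b)" for i by (rule zpow_Suc[OF bij])
  qed (use D g in auto)
qed

theorem corollary6p22:
  fixes x\<^sub>0 :: "'a::metric_space" and \<omega> :: "nat filter" and d :: "nat \<Rightarrow> real"
  assumes "proper_space TYPE('a)"
    and "cocompact_space TYPE('a)"
    and "CAT0_space TYPE('a)"
    and "nonprincipal_ultrafilter \<omega>"
    and "scaling_sequence \<omega> d"
    and "has_cut_point (asymptotic_cone \<omega> (\<lambda>_. x\<^sub>0) d)"
  shows "(\<forall>\<omega>' (e' :: nat \<Rightarrow> 'a) d'.
            nonprincipal_ultrafilter \<omega>' \<longrightarrow> scaling_sequence \<omega>' d' \<longrightarrow>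
            has_cut_point (asymptotic_cone \<omega>' e' d')) \<and>
         (\<exists>\<gamma> :: real \<Rightarrow> 'a. periodic_line \<gamma> \<and> morse_geodesic UNIV \<gamma>)"
proof -
  interpret cone_data \<omega> "\<lambda>_. x\<^sub>0" d using assms by unfold_locales
  have geo: "geodesic_space TYPE('a)" using assms by (simp add: CAT0_space_def)
  obtain g D where "axial_isometry (\<lambda>i. zpow g i x\<^sub>0) (D / 2) (1 / 2) D D g"
    using local_separation_of_cut_point[OF geo assms(2) refl assms(6)]
      axial_isometry_of_local_separation[OF assms(3)] by metis
  then interpret axial_isometry "\<lambda>i. zpow g i x\<^sub>0" "D / 2" "1 / 2" D D g .
  show ?thesis
    using has_cut_point_cone[OF geo assms(2)] periodic_morse_line_exists[OF assms(3,1)] by metis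
qed

end
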